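(* Let $K$ be a field of characteristic $p>0$ and let $a\in K^{{\mathbb N}}$ be a $K$-recurrence sequence of order $d$. Then ${\mathcal Z}(a)=\{n\in{\mathbb N}\mid a(n)=0\}$ is $p$-normal of order $\le d-2$, i.e. there are a $p$-nested set $B$ of order $\le d-2$ and finitely many infinite arithmetic progressions $A_1,\dots,A_s$ such that ${\mathcal Z}(a)$ and $B\cup A_1\cup\dots\cup A_s$ have finite symmetric difference.
   Context: ${\mathbb N}=\{0,1,2,\dots\}$. A sequence $a\in K^{{\mathbb N}}$ is a $K$-recurrence sequence of order $d$ if $d$ is the smallest integer $\ge0$ for which there exist $\gamma_0,\dots,\gamma_{d-1}\in K$ with $a(n+d)=\gamma_{d-1}a(n+d-1)+\cdots+\gamma_0a(n)$ for all $n\in{\mathbb N}$. An infinite arithmetic progression is a set $m+n{\mathbb N}$, $m\in{\mathbb N}$, $n\ge1$. Let $q$ be a power of $p$. For $r\ge1$ and $c_0,\dots,c_r\in{\mathbb Q}$ with $(q-1)c_i\in{\mathbb Z}$ for all $i$, $c_0+\cdots+c_r\in{\mathbb Z}$ and $c_i\neq0$ for $1\le i\le r$, put $S_q(c_0;c_1,\dots,c_r)=\{c_0+c_1q^{k_1}+\cdots+c_rq^{k_r}\mid k_1,\dots,k_r\in{\mathbb N}\}\cap{\mathbb N}$. If moreover $c_i>0$ for some $1\le i\le r$, this set is called an elementary $p$-nested set of order $r$. A $p$-nested set of order $\le k$ is the union of a finite set and finitely many elementary $p$-nested sets (for possibly different powers $q$ of $p$) of orders $\le k$; in particular for $k\le0$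 it is just a finite set. *)

theory Defs
  imports Main "HOL.Rat"
begin

definition has_recurrence :: "(nat \<Rightarrow> 'a::field) \<Rightarrow> nat \<Rightarrow> bool" where
  "has_recurrence a d \<longleftrightarrow>
     (\<exists>\<gamma> :: nat \<Rightarrow> 'a. \<forall>n. a (n + d) = (\<Sum>i<d. \<gamma> i * a (n + i)))"

definition recurrence_order :: "(nat \<Rightarrow> 'a::field) \<Rightarrow> nat \<Rightarrow> bool" where
  "recurrence_order a d \<longleftrightarrow> has_recurrence a d \<and> (\<forall>d'<d. \<not> has_recurrence a d')"

definition S_set :: "nat \<Rightarrow> rat \<Rightarrow> (nat \<Rightarrow> rat) \<Rightarrow> nat \<Rightarrow> nat set" where
  "S_set q c0 c r = {n::nat. \<exists>k :: nat \<Rightarrow> nat.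
      of_nat n = c0 + (\<Sum>i=1..r. c i * of_nat q ^ k i)}"

definition elementary_p_nested :: "nat \<Rightarrow> nat \<Rightarrow> nat set \<Rightarrow> bool" where
  "elementary_p_nested p r S \<longleftrightarrow>
     (\<exists>q e c0 c. e \<ge> 1 \<and> q = p ^ e \<and> r \<ge> 1 \<and>
        (of_nat q - 1) * c0 \<in> \<int> \<and> (\<forall>i\<in>{1..r}. (of_nat q - 1) * c i \<in> \<int>) \<and>
        c0 + (\<Sum>i=1..r. c i) \<in> \<int> \<and>
        (\<forall>i\<in>{1..r}. c i \<noteq> 0) \<and> (\<exists>i\<in>{1..r}. c i > 0) \<and>
        S = S_set q c0 c r)"

text \<open>p-nested set of order \<le> k (k an integer; for k \<le> 0 this is just a finite set).\<close>
definition p_nested :: "nat \<Rightarrow> int \<Rightarrow> nat set \<Rightarrow> bool" where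
  "p_nested p k B \<longleftrightarrow>
     (\<exists>F E. finite F \<and> finite E \<and>
        (\<forall>S\<in>E. \<exists>r. int r \<le> k \<and> elementary_p_nested p r S) \<and>
        B = F \<union> \<Union>E)"

definition arith_prog :: "nat set \<Rightarrow> bool" where
  "arith_prog A \<longleftrightarrow> (\<exists>m n. n \<ge> 1 \<and> A = {m + n * j | j. True})"

end

theory Submission
  imports Defs "HOL-Algebra.Algebraic_Closure_Type"
begin

text \<open>
  Over the algebraic closure and along residue classes, a recurrence sequence is an exponential sum
  with distinct roots, of which no two have a quotient that is a root of unity. More generally,
  consider integers $n$ with $\beta_j^n = \sum_{i \in I} \lambda_{ji} \beta_i^n$ for all $j \in J$,
  and induct on $|I|$. Writing $n = r + pm$ and extracting $p$-th roots gives a system of the same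
  shape for $m$, with coefficients $(\lambda_{ji} (\beta_i/\beta_j)^r)^{1/p}$. If some coefficient
  lies outside a subfield that contains all relevant quotients $\beta_i/\beta_j$, then a linear
  retraction onto the subfield yields one more independent equation, and $|I|$ drops. For a
  suitable subfield of a finitely generated field, at most one digit $r$ does not cause a drop, and
  the coefficients met along this unique path of digits form a finite set. So the path is eventually
  periodic, and the zero set satisfies $Z = E \cup (w + qZ)$ with $E$ of smaller order. The iterates
  of $E$ only give nested sets with constrained exponents; the constraint is removed because a sum
  $\sum_i u_i v_i^{1 + q + \dots + q^{k-1}}$ that vanishes for all large $k$ vanishes for all $k$.
\<close>

subsection \<open>Unions of nested sets of integers\<close>

text \<open>The bound d - 2 is a count. One exponential sum with at most d roots, solved for one of
  them, has |J| = 1 and |I| \<le> d - 1. For |I| = 0 there is no solution, since \<beta>_j^n is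
  nonzero; each index of I costs at most one cycle, which adds one summand to the sets in E and at
  most a single point. So |I| = s leaves fewer than s summands. Systems are needed because a drop
  turns an index of I into one of J: I \<union> J, and with it the condition on quotients, never
  changes. For the digits, let K be generated by the initial coefficients and the quotients, and let
  F = K^(p^k) with k maximal such that F contains all quotients at nonzero coefficients. Such a k
  exists because an element of infinite order is not a p^k-th power in K for every k. Some quotient
  is then no p-th power in F, whereas two digits without a drop would make it one.\<close>

definition repunit :: "int \<Rightarrow> nat \<Rightarrow> int" where
  "repunit q k = (\<Sum>t<k. q ^ t)"

lemma repunit_0 [simp]: "repunit q 0 = 0"
  by (simp add: repunit_def)

lemma repunit_Suc: "repunit q (Suc k) = 1 + q * repunit q k"
  unfolding repunit_def by (subst sum.lessThan_Suc_shift) (simp add: sum_distrib_left)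

lemma repunit_closed: "(q - 1) * repunit q k = q ^ k - 1"
  by (simp add: repunit_def power_diff_1_eq)

lemma repunit_add: "repunit q (k + j) = repunit q j + q ^ j * repunit q k"
  by (induction j) (simp_all add: repunit_Suc algebra_simps)

lemma repunit_mult: "repunit q (m * k) = repunit q m * repunit (q ^ m) k"
proof (induction k)
  case (Suc k)
  have "repunit q (m * Suc k) = repunit q (m * k + m)"
    by (simp add: add.commute)
  then show ?case
    by (simp only: repunit_add Suc.IH repunit_Suc distrib_left mult_1_right mult.assoc mult.left_commute)
qed simp

text \<open>
  The set $S_q(c_0; c_1, \dots, c_r)$ without the intersection with the natural numbers, in terms
  of the integers $b_i = (q-1) c_i$ and $n = c_0 + \dots + c_r$, so that
  $c_0 + \sum_i c_i q^{k_i} = n + \sum_i b_i (1 + q + \dots + q^{k_i - 1})$. Here the exponents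
  are restricted to $k_i \ge j$, and some $b_i$ may be zero.
\<close>

primrec nest :: "int \<Rightarrow> nat \<Rightarrow> int list \<Rightarrow> int \<Rightarrow> int set" where
  "nest q j [] n = {n}"
| "nest q j (b # bs) n = (\<Union>k\<in>{j..}. nest q j bs (n + b * repunit q k))"

lemma nest_affine:
  "(\<lambda>x. w + t * x) ` nest q j bs n = nest q j (map ((*) t) bs) (w + t * n)"
  by (induction bs arbitrary: n) (simp_all add: image_UN algebra_simps)

text \<open>The map is the j-th iterate of x -> w + q x. Since
  \<open>q ^ j * repunit q k = repunit q (k + j) - repunit q j\<close>, scaling moves every exponent
  up by j, and all corrections are multiples of \<open>repunit q j\<close>. So the iterates of one
  nest look like a single nest with one more entry, except that the other exponents stay \<ge>
  j.\<close>

lemma nest_scale: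
  "(\<lambda>x. q ^ j * x + w * repunit q j) ` nest q 0 bs n =
     nest q j bs (n + (w + (q - 1) * n - sum_list bs) * repunit q j)"
proof (induction bs arbitrary: n)
  case Nil
  have "q ^ j = 1 + (q - 1) * repunit q j"
    by (simp add: repunit_closed)
  then show ?case
    unfolding nest.simps by (simp del: repunit_closed add: distrib_right left_diff_distrib)
next
  case (Cons b bs)
  have q: "q ^ j = 1 + (q - 1) * repunit q j"
    by (simp add: repunit_closed)
  have eq: "n + b * repunit q k + (w + (q - 1) * (n + b * repunit q k) - sum_list bs) * repunit q j
    = n + (w + (q - 1) * n - sum_list (b # bs)) * repunit q j + b * repunit q (k + j)" for k
    unfolding repunit_add q by (simp add: algebra_simps)
  have "{j..} = (\<lambda>k. k + j) ` {0..}"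
    by (auto simp: image_iff) (metis le_add_diff_inverse2)
  then show ?case
    by (simp add: image_UN Cons.IH eq del: sum_list.Cons)
qed

text \<open>Each exponent is split as t + m k with t < m. One family \<open>A\<close> of entries and
  offsets has to serve all \<open>n\<close>, because the induction applies it to shifted starting
  points.\<close>

lemma nest_power:
  assumes "m \<ge> 1"
  shows "\<exists>A. finite A \<and> (\<forall>(bs', c)\<in>A. length bs' = length bs) \<and>
    (\<forall>n. nest q 0 bs n = (\<Union>(bs', c)\<in>A. nest (q ^ m) 0 bs' (n + c)))"
proof (induction bs)
  case Nil
  show ?case
    by (rule exI[of _ "{([], 0)}"]) simp
next
  case (Cons b bs)
  then obtain A where A: "finite A" "\<forall>(bs', c)\<in>A. length bs' = length bs"
    "\<And>n. nest q 0 bs n = (\<Union>(bs', c)\<in>A. nest (q ^ m) 0 bs' (n + c))"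
    by blast
  define f where "f = (\<lambda>(t, bs', c). (b * q ^ t * repunit q m # bs', b * repunit q t + c))"
  have split: "b * repunit q (t + m * k) = b * repunit q t + b * q ^ t * repunit q m * repunit (q ^ m) k" for t k
    unfolding repunit_add[of q "m * k" t, unfolded add.commute[of "m * k"]] repunit_mult
    by (simp add: algebra_simps)
  have UN: "(\<Union>k. G k) = (\<Union>t\<in>{..<m}. \<Union>k. G (t + m * k))" for G :: "nat \<Rightarrow> int set"
  proof -
    have "\<exists>t\<in>{..<m}. \<exists>k'. G k = G (t + m * k')" for k
      using assms by (intro bexI[of _ "k mod m"] exI[of _ "k div m"]) auto
    then show ?thesis
      by blast
  qed
  have eq: "n + b * repunit q (t + m * k) + c =
      n + (b * repunit q t + c) + b * q ^ t * repunit q m * repunit (q ^ m) k" for n t k c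
    unfolding split by (simp add: algebra_simps)
  have "nest q 0 (b # bs) n = (\<Union>(bs', c)\<in>f ` ({..<m} \<times> A). nest (q ^ m) 0 bs' (n + c))" for n
  proof -
    have "nest q 0 (b # bs) n =
        (\<Union>t\<in>{..<m}. \<Union>k. \<Union>(bs', c)\<in>A. nest (q ^ m) 0 bs' (n + b * repunit q (t + m * k) + c))"
      by (simp add: A(3) UN[of "\<lambda>k. \<Union>(bs', c)\<in>A. nest (q ^ m) 0 bs' (n + b * repunit q k + c)"])
    also have "\<dots> = (\<Union>(bs', c)\<in>f ` ({..<m} \<times> A). nest (q ^ m) 0 bs' (n + c))"
      unfolding eq f_def by fastforce
    finally show ?thesis .
  qed
  moreover have "\<forall>(bs', c)\<in>f ` ({..<m} \<times> A). length bs' = length (b # bs)"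
    using A(2) by (auto simp: f_def)
  moreover have "finite (f ` ({..<m} \<times> A))"
    using A(1) by simp
  ultimately show ?case
    by blast
qed

text \<open>The bound is strict so that \<open>s = 0\<close> leaves only the empty set and
  \<open>s = 1\<close> the finite sets, which matches systems with no free base and with
  one.\<close>

definition nested :: "int \<Rightarrow> nat \<Rightarrow> int set \<Rightarrow> bool" where
  "nested q s Z \<longleftrightarrow> (\<exists>A. finite A \<and> (\<forall>(bs, n)\<in>A. length bs < s) \<and>
     Z = (\<Union>(bs, n)\<in>A. nest q 0 bs n))"

lemma nested_empty [simp]: "nested q s {}"
  unfolding nested_def by (rule exI[of _ "{}"]) simp

lemma nested_singleton:
  assumes "s > 0"
  shows "nested q s {n}"
  unfolding nested_def by (rule exI[of _ "{([], n)}"]) (use assms in simp)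

lemma nested_Un:
  assumes "nested q s Z" "nested q s Y"
  shows "nested q s (Z \<union> Y)"
proof -
  obtain A B where
    "finite A" "\<forall>(bs, n)\<in>A. length bs < s" "Z = (\<Union>(bs, n)\<in>A. nest q 0 bs n)"
    "finite B" "\<forall>(bs, n)\<in>B. length bs < s" "Y = (\<Union>(bs, n)\<in>B. nest q 0 bs n)"
    using assms unfolding nested_def by blast
  then show ?thesis
    unfolding nested_def by (intro exI[of _ "A \<union> B"]) auto
qed

lemma nested_mono:
  assumes "nested q s Z" "s \<le> s'"
  shows "nested q s' Z"
proof -
  obtain A where "finite A" "\<forall>(bs, n)\<in>A. length bs < s" "Z = (\<Union>(bs, n)\<in>A. nest q 0 bs n)"
    using assms(1) unfolding nested_def by blast
  then show ?thesis
    unfolding nested_def using assms(2) by (intro exI[of _ A]) auto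
qed

lemma nested_affine:
  assumes "nested q s Z"
  shows "nested q s ((\<lambda>x. w + t * x) ` Z)"
proof -
  obtain A where A: "finite A" "\<forall>(bs, n)\<in>A. length bs < s" "Z = (\<Union>(bs, n)\<in>A. nest q 0 bs n)"
    using assms unfolding nested_def by blast
  define f where "f = (\<lambda>(bs, n). (map ((*) t) bs, w + t * n))"
  have "(\<lambda>x. w + t * x) ` Z = (\<Union>(bs, n)\<in>f ` A. nest q 0 bs n)"
    by (simp add: A(3) f_def image_UN nest_affine split_beta)
  then show ?thesis
    unfolding nested_def using A by (intro exI[of _ "f ` A"]) (auto simp: f_def)
qed

lemma nested_power:
  assumes "nested q s Z" "m \<ge> 1"
  shows "nested (q ^ m) s Z"
proof -
  obtain A where A: "finite A" "\<forall>(bs, n)\<in>A. length bs < s" "Z = (\<Union>(bs, n)\<in>A. nest q 0 bs n)"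
    using assms unfolding nested_def by blast
  have "\<forall>bs. \<exists>B. finite B \<and> (\<forall>(bs', c)\<in>B. length bs' = length bs) \<and>
    (\<forall>n. nest q 0 bs n = (\<Union>(bs', c)\<in>B. nest (q ^ m) 0 bs' (n + c)))"
    using nest_power[OF assms(2)] by blast
  then obtain B where B: "\<And>bs. finite (B bs)" "\<And>bs. \<forall>(bs', c)\<in>B bs. length bs' = length bs"
    "\<And>bs n. nest q 0 bs n = (\<Union>(bs', c)\<in>B bs. nest (q ^ m) 0 bs' (n + c))"
    by metis
  define C where "C = (\<Union>(bs, n)\<in>A. (\<lambda>(bs', c). (bs', n + c)) ` B bs)"
  have "finite C"
    unfolding C_def using A(1) B(1) by auto
  moreover have "\<forall>(bs, n)\<in>C. length bs < s"
    unfolding C_def using A(2) B(2) by fastforce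
  moreover have "Z = (\<Union>(bs, n)\<in>C. nest (q ^ m) 0 bs n)"
    unfolding C_def A(3) B(3) by fastforce
  ultimately show ?thesis
    unfolding nested_def by blast
qed

text \<open>This is what removes the lower bounds on exponents left by \<open>nest_scale\<close>.
  For zero sets it will come from Frobenius orbits.\<close>

definition tail_closed :: "int \<Rightarrow> int set \<Rightarrow> bool" where
  "tail_closed q Z \<longleftrightarrow>
     (\<forall>n b j. (\<forall>k\<ge>j. n + b * repunit q k \<in> Z) \<longrightarrow> (\<forall>k. n + b * repunit q k \<in> Z))"

text \<open>The exponents are released one at a time. With all but the first held fixed, the points
  are \<open>y + b * repunit q k'\<close>; nests with the same entries are translates of each other,
  so the induction hypothesis covers all k' \<ge> j, and tail closedness the rest.\<close>

lemma tail_closed_nest: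
  assumes "tail_closed q Z" "nest q j bs n \<subseteq> Z"
  shows "nest q 0 bs n \<subseteq> Z"
proof -
  have "x \<in> Z" if "x \<in> nest q 0 bs n" "nest q j bs n \<subseteq> Z" for x
    using that
  proof (induction bs arbitrary: n x)
    case (Cons b bs)
    obtain k where k: "x \<in> nest q 0 bs (n + b * repunit q k)"
      using Cons.prems by auto
    define y where "y = x - b * repunit q k"
    have shift: "(\<lambda>z. (m' - m) + 1 * z) ` nest q 0 bs m = nest q 0 bs m'" for m m'
      by (subst nest_affine) (simp add: map_idI)
    have mem: "y + b * repunit q k' \<in> nest q 0 bs (n + b * repunit q k')" for k'
    proof -
      have "y + b * repunit q k' =
          ((n + b * repunit q k') - (n + b * repunit q k)) + 1 * x"
        by (simp add: y_def)
      then show ?thesis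
        using k unfolding shift[of "n + b * repunit q k'" "n + b * repunit q k", symmetric] by blast
    qed
    have "y + b * repunit q k' \<in> Z" if "k' \<ge> j" for k'
    proof (rule Cons.IH[OF mem])
      show "nest q j bs (n + b * repunit q k') \<subseteq> Z"
        using Cons.prems(2) that by auto
    qed
    then have "y + b * repunit q k \<in> Z"
      using assms(1) unfolding tail_closed_def by blast
    then show ?case
      by (simp add: y_def)
  qed auto
  then show ?thesis
    using assms(2) by blast
qed

lemma affine_iterate:
  "((\<lambda>x. w + q * x) ^^ j) x = q ^ j * x + w * repunit q (j :: nat)" for q :: int
  by (induction j) (simp_all add: repunit_Suc algebra_simps)

text \<open>Such a point is q-adically the fixed point w / (1 - q) of x -> w + q x, so there is at
  most one.\<close>

lemma unique_common_iterate:
  assumes "q \<ge> 2" "\<And>j :: nat. \<exists>u. x = q ^ j * u + w * repunit q j"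
    "\<And>j :: nat. \<exists>u. y = q ^ j * u + w * repunit q j"
  shows "x = (y :: int)"
proof (rule ccontr)
  assume "x \<noteq> y"
  define j where "j = nat \<bar>x - y\<bar>"
  obtain u v where "x = q ^ j * u + w * repunit q j" "y = q ^ j * v + w * repunit q j"
    using assms(2,3) by meson
  then have "q ^ j dvd x - y"
    by (simp add: algebra_simps flip: right_diff_distrib)
  then have "q ^ j \<le> \<bar>x - y\<bar>"
    using \<open>x \<noteq> y\<close> by (intro zdvd_imp_le) auto
  moreover have "int j < 2 ^ j"
    by (metis less_exp of_nat_less_iff of_nat_numeral of_nat_power)
  moreover have "(2::int) ^ j \<le> q ^ j"
    using assms(1) by (intro power_mono) auto
  ultimately show False
    by (simp add: j_def)
qed

text \<open>Unrolling exhibits a point of Z as an iterate of a point of E, or leaves it in the image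
  of the j-th iterate. The first kind is covered by \<open>nest_scale\<close> with a fresh entry,
  and \<open>tail_closed_nest\<close> shows that dropping the bound on the other exponents does not
  lead out of Z. Points that are of the second kind for every j form at most a singleton.\<close>

lemma nested_cycle:
  assumes q: "q \<ge> 2" and Z: "Z = E \<union> (\<lambda>x. w + q * x) ` Z"
    and E: "nested q s E" and closed: "tail_closed q Z"
  shows "nested q (Suc s) Z"
proof -
  obtain A where A: "finite A" "\<forall>(bs, n)\<in>A. length bs < s" "E = (\<Union>(bs, n)\<in>A. nest q 0 bs n)"
    using E unfolding nested_def by blast
  define \<phi> where "\<phi> = (\<lambda>x. w + q * x)"
  have iter: "(\<phi> ^^ j) x = q ^ j * x + w * repunit q j" for j x
    unfolding \<phi>_def by (rule affine_iterate)
  have \<phi>Z: "(\<phi> ^^ j) x \<in> Z" if "x \<in> Z" for j x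
    using that Z by (induction j) (auto simp: \<phi>_def)
  \<comment> \<open>The new entry is the factor of \<open>repunit q j\<close> in
    \<open>nest_scale\<close>; its exponent is the number of iterations.\<close>
  define f where "f = (\<lambda>(bs, n). ((w + (q - 1) * n - sum_list bs) # bs, n))"
  define R where "R = {x. \<forall>j. \<exists>u. x = (\<phi> ^^ j) u}"
  have part: "nest q 0 ((w + (q - 1) * n - sum_list bs) # bs) n \<subseteq> Z" if "(bs, n) \<in> A" for bs n
  proof -
    have "nest q 0 bs (n + (w + (q - 1) * n - sum_list bs) * repunit q j) \<subseteq> Z" for j
    proof (rule tail_closed_nest[OF closed, of j])
      have "nest q 0 bs n \<subseteq> Z"
        using that A(3) Z by blast
      then show "nest q j bs (n + (w + (q - 1) * n - sum_list bs) * repunit q j) \<subseteq> Z"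
        unfolding nest_scale[symmetric] using \<phi>Z by (auto simp flip: iter)
    qed
    then show ?thesis
      by auto
  qed
  have cover: "x \<in> (\<Union>(bs, n)\<in>f ` A. nest q 0 bs n) \<or> (\<exists>u\<in>Z. x = (\<phi> ^^ j) u)" if "x \<in> Z" for x j
  proof (induction j)
    case 0
    then show ?case
      using that by auto
  next
    case (Suc j)
    then consider "x \<in> (\<Union>(bs, n)\<in>f ` A. nest q 0 bs n)" | u where "u \<in> Z" "x = (\<phi> ^^ j) u"
      by blast
    then show ?case
    proof cases
      case 2
      consider "u \<in> E" | v where "v \<in> Z" "u = \<phi> v"
        using 2(1) Z unfolding \<phi>_def by blast
      then show ?thesis
      proof cases
        case 1
        then obtain bs n where bn: "(bs, n) \<in> A" "u \<in> nest q 0 bs n"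
          using A(3) by auto
        let ?c = "w + (q - 1) * n - sum_list bs"
        have "x \<in> nest q j bs (n + ?c * repunit q j)"
          unfolding nest_scale[symmetric] using bn(2) 2(2) iter by auto
        moreover have "nest q j bs' n' \<subseteq> nest q 0 bs' n'" for bs' n'
          by (induction bs' arbitrary: n') fastforce+
        ultimately have "x \<in> nest q 0 (?c # bs) n"
          by auto
        then show ?thesis
          using bn(1) by (force simp: f_def)
      next
        case 2
        then have "x = (\<phi> ^^ Suc j) v"
          using \<open>x = (\<phi> ^^ j) u\<close> by (simp add: funpow_swap1)
        then show ?thesis
          using 2 by blast
      qed
    qed auto
  qed
  have eq: "Z = (\<Union>(bs, n)\<in>f ` A. nest q 0 bs n) \<union> (Z \<inter> R)"
    using cover part by (force simp: f_def R_def)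
  have "nested q (Suc s) (\<Union>(bs, n)\<in>f ` A. nest q 0 bs n)"
    unfolding nested_def using A(1,2) by (intro exI[of _ "f ` A"]) (auto simp: f_def)
  moreover have "nested q (Suc s) (Z \<inter> R)"
  proof (cases "Z \<inter> R = {}")
    case False
    then obtain x where "x \<in> Z \<inter> R"
      by blast
    moreover have "y = x" if "y \<in> Z \<inter> R" for y
      using unique_common_iterate[OF q, of y w x] that \<open>x \<in> Z \<inter> R\<close> by (auto simp: R_def iter)
    ultimately have "Z \<inter> R = {x}"
      by blast
    then show ?thesis
      by (simp add: nested_singleton)
  qed simp
  ultimately have "nested q (Suc s) ((\<Union>(bs, n)\<in>f ` A. nest q 0 bs n) \<union> (Z \<inter> R))"
    by (rule nested_Un)
  then show ?thesis
    by (rule ssubst[OF eq])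
qed

text \<open>The bases p^d and p^e have the common power p^(d e), so one unspecified exponent is
  enough even for unions of sets with different bases.\<close>

definition p_nested_int :: "nat \<Rightarrow> nat \<Rightarrow> int set \<Rightarrow> bool" where
  "p_nested_int p s Z \<longleftrightarrow> (\<exists>e\<ge>1. nested (int p ^ e) s Z)"

lemma p_nested_int_empty [simp]: "p_nested_int p s {}"
  unfolding p_nested_int_def using nested_empty by blast

lemma p_nested_int_Un:
  assumes "p_nested_int p s Z" "p_nested_int p s Y"
  shows "p_nested_int p s (Z \<union> Y)"
proof -
  obtain d e where "d \<ge> 1" "e \<ge> 1" "nested (int p ^ d) s Z" "nested (int p ^ e) s Y"
    using assms unfolding p_nested_int_def by blast
  then have "nested (int p ^ (d * e)) s Z" "nested (int p ^ (d * e)) s Y"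
    using nested_power[of "int p ^ d" s Z e] nested_power[of "int p ^ e" s Y d]
    by (simp_all add: mult.commute flip: power_mult)
  then show ?thesis
    unfolding p_nested_int_def using nested_Un \<open>d \<ge> 1\<close> \<open>e \<ge> 1\<close>
    by (metis mult_le_mono nat_mult_1)
qed

lemma p_nested_int_UN:
  assumes "finite T" "\<And>t. t \<in> T \<Longrightarrow> p_nested_int p s (Z t)"
  shows "p_nested_int p s (\<Union>t\<in>T. Z t)"
  using assms by (induction T) (auto intro: p_nested_int_Un)

lemma p_nested_int_mono:
  assumes "p_nested_int p s Z" "s \<le> s'"
  shows "p_nested_int p s' Z"
  using assms nested_mono unfolding p_nested_int_def by blast

lemma p_nested_int_affine:
  assumes "p_nested_int p s Z"
  shows "p_nested_int p s ((\<lambda>x. w + t * x) ` Z)"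
  using assms nested_affine unfolding p_nested_int_def by blast

text \<open>The multiplier p^m and the base p^e of E need not agree. Iterating the equation e times
  turns the multiplier into p^(m e), and \<open>nested_power\<close> refines the base to the same
  power. Tail closedness is asked for all l because e only appears here.\<close>

lemma p_nested_int_cycle:
  assumes p: "p \<ge> 2" and m: "m \<ge> 1" and Z: "Z = E \<union> (\<lambda>x. w + int p ^ m * x) ` Z"
    and E: "p_nested_int p s E" and closed: "\<And>l. tail_closed (int p ^ l) Z"
  shows "p_nested_int p (Suc s) Z"
proof -
  obtain e where e: "e \<ge> 1" "nested (int p ^ e) s E"
    using E unfolding p_nested_int_def by blast
  have iter: "\<exists>E' w'. nested (int p ^ e) s E' \<and>
      Z = E' \<union> (\<lambda>x. w' + (int p ^ m) ^ j * x) ` Z" for j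
  proof (induction j)
    case 0
    then show ?case
      by (intro exI[of _ "{}"] exI[of _ 0]) auto
  next
    case (Suc j)
    then obtain E' w' where E': "nested (int p ^ e) s E'"
      "Z = E' \<union> (\<lambda>x. w' + (int p ^ m) ^ j * x) ` Z"
      by blast
    let ?E = "E' \<union> (\<lambda>x. w' + (int p ^ m) ^ j * x) ` E"
    have N: "nested (int p ^ e) s ?E"
      using E'(1) e(2) by (intro nested_Un nested_affine)
    have "Z = E' \<union> (\<lambda>x. w' + (int p ^ m) ^ j * x) ` (E \<union> (\<lambda>x. w + int p ^ m * x) ` Z)"
      using E'(2) Z by simp
    also have "\<dots> = ?E \<union> (\<lambda>x. (w' + (int p ^ m) ^ j * w) + (int p ^ m) ^ Suc j * x) ` Z"
      unfolding image_Un image_image by (auto simp: algebra_simps)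
    finally show ?case
      by (intro exI conjI) (rule N)
  qed
  obtain E' w' where E': "nested (int p ^ e) s E'" "Z = E' \<union> (\<lambda>x. w' + (int p ^ m) ^ e * x) ` Z"
    using iter by blast
  have pm: "(int p ^ m) ^ e = int p ^ (e * m)"
    by (simp add: power_mult[symmetric] mult.commute)
  have "nested (int p ^ (e * m)) (Suc s) Z"
  proof (rule nested_cycle)
    have "1 \<le> e * m"
      using e(1) m by (simp add: Suc_le_eq)
    then have "int p ^ 1 \<le> int p ^ (e * m)"
      using p by (intro power_increasing) auto
    moreover have "2 \<le> int p ^ 1"
      using p by simp
    ultimately show "2 \<le> int p ^ (e * m)"
      by (rule order_trans[rotated])
    show "Z = E' \<union> (\<lambda>x. w' + int p ^ (e * m) * x) ` Z"
      using E'(2) pm by simp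
    show "nested (int p ^ (e * m)) s E'"
      using nested_power[OF E'(1) m] by (simp add: power_mult)
  qed (rule closed)
  then show ?thesis
    unfolding p_nested_int_def using e(1) m by (metis mult_le_mono nat_mult_1)
qed

subsection \<open>A finite set closed under extraction of p-th roots\<close>

definition is_subfield :: "'a::field set \<Rightarrow> bool" where
  "is_subfield F \<longleftrightarrow> 0 \<in> F \<and> 1 \<in> F \<and> (\<forall>x\<in>F. \<forall>y\<in>F. x - y \<in> F \<and> x * y \<in> F \<and> x / y \<in> F)"

lemma is_subfieldD:
  assumes "is_subfield F"
  shows "0 \<in> F" "1 \<in> F" "\<And>x y. x \<in> F \<Longrightarrow> y \<in> F \<Longrightarrow> x - y \<in> F"
    "\<And>x y. x \<in> F \<Longrightarrow> y \<in> F \<Longrightarrow> x * y \<in> F" "\<And>x y. x \<in> F \<Longrightarrow> y \<in> F \<Longrightarrow> x / y \<in> F"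
    "\<And>x y. x \<in> F \<Longrightarrow> y \<in> F \<Longrightarrow> x + y \<in> F" "\<And>x n. x \<in> F \<Longrightarrow> x ^ n \<in> F"
proof -
  note F = assms[unfolded is_subfield_def]
  show "0 \<in> F" "1 \<in> F" "\<And>x y. x \<in> F \<Longrightarrow> y \<in> F \<Longrightarrow> x - y \<in> F"
    and mult: "\<And>x y. x \<in> F \<Longrightarrow> y \<in> F \<Longrightarrow> x * y \<in> F"
    and "\<And>x y. x \<in> F \<Longrightarrow> y \<in> F \<Longrightarrow> x / y \<in> F"
    using F by auto
  show "x + y \<in> F" if "x \<in> F" "y \<in> F" for x y
  proof -
    have "x - (0 - y) \<in> F"
      using F that by blast
    then show ?thesis
      by simp
  qed
  show "x ^ n \<in> F" if "x \<in> F" for x n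
    using that F by (induction n) auto
qed

lemma is_subfield_powi:
  assumes "is_subfield F" "x \<in> F"
  shows "x powi n \<in> F"
proof -
  have "1 / x \<in> F"
    using is_subfieldD(2,5)[OF assms(1)] assms(2) by blast
  then show ?thesis
    using is_subfieldD(7)[OF assms(1)] assms(2) by (auto simp: power_int_def inverse_eq_divide)
qed

lemma is_subfield_sum:
  assumes "is_subfield F" "\<And>i. i \<in> I \<Longrightarrow> f i \<in> F"
  shows "sum f I \<in> F"
  using assms(2) by (induction I rule: infinite_finite_induct)
    (auto intro: is_subfieldD[OF assms(1)])

text \<open>The \<kappa> i are the values at l i of an F-linear retraction onto F, recorded only
  through its effect on combinations that already lie in F. In the induction, either l a lies in F
  plus the F-span of the others, and its value is forced, or it is independent of them and may be
  sent to 0.\<close>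

lemma subfield_retraction:
  assumes F: "is_subfield F" and "finite I"
  shows "\<exists>\<kappa>. (\<forall>i. \<kappa> i \<in> F) \<and> (\<forall>x. (\<forall>i\<in>I. x i \<in> F) \<longrightarrow> (\<Sum>i\<in>I. x i * l i) \<in> F \<longrightarrow>
           (\<Sum>i\<in>I. x i * l i) = (\<Sum>i\<in>I. x i * \<kappa> i))"
  using assms(2)
proof (induction I)
  case empty
  then show ?case
    using is_subfieldD[OF F] by (intro exI[of _ "\<lambda>_. 0"]) auto
next
  case (insert a I)
  note [intro] = is_subfieldD[OF F] is_subfield_sum[OF F]
  obtain \<kappa> where \<kappa>: "\<And>i. \<kappa> i \<in> F"
    "\<And>x. (\<forall>i\<in>I. x i \<in> F) \<Longrightarrow> (\<Sum>i\<in>I. x i * l i) \<in> F \<Longrightarrow>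
           (\<Sum>i\<in>I. x i * l i) = (\<Sum>i\<in>I. x i * \<kappa> i)"
    using insert.IH by blast
  show ?case
  proof (cases "\<exists>y. (\<forall>i\<in>I. y i \<in> F) \<and> l a + (\<Sum>i\<in>I. y i * l i) \<in> F")
    case True
    then obtain y where y: "\<And>i. i \<in> I \<Longrightarrow> y i \<in> F" "l a + (\<Sum>i\<in>I. y i * l i) \<in> F"
      by blast
    define c where "c = l a + (\<Sum>i\<in>I. y i * l i)"
    define \<kappa>' where "\<kappa>' = \<kappa>(a := c - (\<Sum>i\<in>I. y i * \<kappa> i))"
    have c: "c \<in> F"
      using y(2) by (simp add: c_def)
    have "(\<Sum>i\<in>I. y i * \<kappa> i) \<in> F"
      using \<kappa>(1) y(1) by (intro is_subfield_sum[OF F] is_subfieldD(4)[OF F])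
    then have "\<kappa>' i \<in> F" for i
      unfolding \<kappa>'_def using \<kappa>(1) c is_subfieldD(3)[OF F] by auto
    moreover have "(\<Sum>i\<in>insert a I. x i * l i) = (\<Sum>i\<in>insert a I. x i * \<kappa>' i)"
      if x: "\<forall>i\<in>insert a I. x i \<in> F" "(\<Sum>i\<in>insert a I. x i * l i) \<in> F" for x
    proof -
      have split: "(\<Sum>i\<in>insert a I. x i * l i) = x a * c + (\<Sum>i\<in>I. (x i - x a * y i) * l i)"
        using insert.hyps by (simp add: c_def algebra_simps sum_subtractf sum_distrib_left)
      have "(\<Sum>i\<in>I. (x i - x a * y i) * l i) = (\<Sum>i\<in>insert a I. x i * l i) - x a * c"
        using split by simp
      also have "\<dots> \<in> F"
        using x y(2) by (auto simp: c_def)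
      finally have "(\<Sum>i\<in>I. (x i - x a * y i) * l i) = (\<Sum>i\<in>I. (x i - x a * y i) * \<kappa> i)"
        using x(1) y(1) by (intro \<kappa>(2)) auto
      moreover have "(\<Sum>i\<in>insert a I. x i * \<kappa>' i) = x a * c + (\<Sum>i\<in>I. (x i - x a * y i) * \<kappa> i)"
      proof -
        have "(\<Sum>i\<in>I. x i * \<kappa>' i) = (\<Sum>i\<in>I. x i * \<kappa> i)"
          using insert.hyps by (intro sum.cong) (auto simp: \<kappa>'_def)
        then show ?thesis
          using insert.hyps by (simp add: \<kappa>'_def algebra_simps sum_subtractf sum_distrib_left)
      qed
      ultimately show ?thesis
        using split by simp
    qed
    ultimately show ?thesis
      by blast
  next
    case False
    have "(\<Sum>i\<in>insert a I. x i * l i) = (\<Sum>i\<in>insert a I. x i * (\<kappa>(a := 0)) i)"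
      if x: "\<forall>i\<in>insert a I. x i \<in> F" "(\<Sum>i\<in>insert a I. x i * l i) \<in> F" for x
    proof -
      have xa: "x a = 0"
      proof (rule ccontr)
        assume "x a \<noteq> 0"
        then have "l a + (\<Sum>i\<in>I. (x i / x a) * l i) = (\<Sum>i\<in>insert a I. x i * l i) / x a"
          using insert.hyps by (simp add: sum_divide_distrib add_divide_distrib)
        also have "\<dots> \<in> F"
          using x by auto
        finally show False
          using False x(1) by (metis insertI1 insertI2 is_subfieldD(5)[OF F])
      qed
      have "(\<Sum>i\<in>I. x i * l i) = (\<Sum>i\<in>I. x i * \<kappa> i)"
        using x xa insert.hyps by (intro \<kappa>(2)) auto
      also have "\<dots> = (\<Sum>i\<in>I. x i * (\<kappa>(a := 0)) i)"
        using insert.hyps by (intro sum.cong) auto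
      finally show ?thesis
        using xa insert.hyps by simp
    qed
    moreover have "(\<kappa>(a := 0)) i \<in> F" for i
      using \<kappa>(1) by auto
    ultimately show ?thesis
      by blast
  qed
qed

section \<open>Expressions of bounded degree in finitely many generators\<close>

inductive_set add_span :: "'a::comm_monoid_add set \<Rightarrow> 'a set" for M where
  zero: "0 \<in> add_span M"
| step: "m \<in> M \<Longrightarrow> y \<in> add_span M \<Longrightarrow> m + y \<in> add_span M"

lemma add_span_add:
  assumes "x \<in> add_span M" "y \<in> add_span M"
  shows "x + y \<in> add_span M"
  using assms by induction (auto simp: add.assoc intro: add_span.intros)

lemma add_span_superset:
  assumes "x \<in> M"
  shows "x \<in> add_span M"
  using add_span.step[OF assms add_span.zero] by simp

lemma add_span_mono:
  assumes "M \<subseteq> N"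
  shows "add_span M \<subseteq> add_span N"
proof
  fix x assume "x \<in> add_span M"
  then show "x \<in> add_span N"
    by induction (use assms in \<open>auto intro: add_span.intros\<close>)
qed

lemma add_span_mult:
  fixes x y :: "'a::comm_semiring_0"
  assumes "x \<in> add_span M" "y \<in> add_span N" "\<And>m n. m \<in> M \<Longrightarrow> n \<in> N \<Longrightarrow> m * n \<in> P"
  shows "x * y \<in> add_span P"
  using assms(1)
proof induction
  case (step m x)
  have "m * y \<in> add_span P"
    using assms(2)
    by induction (auto simp: distrib_left intro: add_span.intros assms(3) step.hyps)
  then show ?case
    using step.IH by (simp add: distrib_right add_span_add)
qed (simp add: add_span.zero)

text \<open>In positive characteristic, sums without scalars already form a space over the prime
  field: the multiplicity of m counts only modulo the characteristic.\<close>

lemma finite_add_span: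
  fixes M :: "'a::field set"
  assumes "finite M" "CHAR('a) > 0"
  shows "finite (add_span M)"
  using assms(1)
proof (induction M)
  case empty
  have "x = 0" if "x \<in> add_span {}" for x :: 'a
    using that by induction auto
  then have "add_span ({} :: 'a set) \<subseteq> {0}"
    by blast
  then show ?case
    using finite_subset by blast
next
  case (insert m M)
  let ?f = "\<lambda>(c, y). of_nat c * m + y"
  let ?S = "?f ` ({..<CHAR('a)} \<times> add_span M)"
  have "x \<in> ?S" if "x \<in> add_span (insert m M)" for x
    using that
  proof induction
    case zero
    have "(0, 0) \<in> {..<CHAR('a)} \<times> add_span M"
      using assms(2) by (simp add: add_span.zero)
    then show ?case
      by force
  next
    case (step n x)
    then obtain c y where cy: "c < CHAR('a)" "y \<in> add_span M" "x = of_nat c * m + y"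
      by auto
    show ?case
    proof (cases "n = m")
      case True
      then have nx: "n + x = of_nat (Suc c) * m + y"
        using cy(3) by (simp add: algebra_simps)
      show ?thesis
      proof (cases "Suc c = CHAR('a)")
        case True
        then have "n + x = ?f (0, y)"
          using nx by (simp del: of_nat_Suc)
        then show ?thesis
          using cy assms(2) by blast
      next
        case False
        then have "n + x = ?f (Suc c, y)" "Suc c < CHAR('a)"
          using nx cy(1) by auto
        then show ?thesis
          using cy by blast
      qed
    next
      case False
      then have "n + y \<in> add_span M"
        using step.hyps(1) cy(2) by (auto intro: add_span.step)
      moreover have "n + x = ?f (c, n + y)"
        using cy(3) by (simp add: algebra_simps)
      ultimately show ?thesis
        using cy(1) by blast
    qed
  qed
  then have "add_span (insert m M) \<subseteq> ?S"
    by blast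
  then show ?case
    using insert.IH finite_subset by blast
qed

text \<open>Field elements, not formal monomials: no independence of \<open>G\<close> is assumed.
  Bounding each exponent separately, rather than the total degree, lets division with remainder by p
  act exponentwise.\<close>

definition monomials :: "'a::field set \<Rightarrow> nat \<Rightarrow> 'a set" where
  "monomials G s = {\<Prod>g\<in>G. g ^ \<alpha> g | \<alpha>. \<forall>g\<in>G. \<alpha> g \<le> s}"

lemma finite_monomials:
  assumes "finite G"
  shows "finite (monomials G s)"
proof -
  have "monomials G s \<subseteq> (\<lambda>\<alpha>. \<Prod>g\<in>G. g ^ \<alpha> g) ` (G \<rightarrow>\<^sub>E {..s})"
  proof
    fix x assume "x \<in> monomials G s"
    then obtain \<alpha> where "x = (\<Prod>g\<in>G. g ^ \<alpha> g)" "\<forall>g\<in>G. \<alpha> g \<le> s"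
      by (auto simp: monomials_def)
    then show "x \<in> (\<lambda>\<alpha>. \<Prod>g\<in>G. g ^ \<alpha> g) ` (G \<rightarrow>\<^sub>E {..s})"
      by (intro image_eqI[of _ _ "restrict \<alpha> G"]) auto
  qed
  then show ?thesis
    using assms by (meson finite_PiE finite_atMost finite_imageI finite_subset)
qed

lemma monomials_mult:
  assumes "m \<in> monomials G s" "n \<in> monomials G t"
  shows "m * n \<in> monomials G (s + t)"
proof -
  obtain \<alpha> \<beta> where "m = (\<Prod>g\<in>G. g ^ \<alpha> g)" "\<forall>g\<in>G. \<alpha> g \<le> s"
    "n = (\<Prod>g\<in>G. g ^ \<beta> g)" "\<forall>g\<in>G. \<beta> g \<le> t"
    using assms by (auto simp: monomials_def)
  then show ?thesis
    unfolding monomials_def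
    by (intro CollectI exI[of _ "\<lambda>g. \<alpha> g + \<beta> g"]) (auto simp: power_add prod.distrib intro: add_mono)
qed

lemma one_in_monomials: "1 \<in> monomials G s"
  unfolding monomials_def by (intro CollectI exI[of _ "\<lambda>_. 0"]) auto

lemma generator_in_monomials:
  assumes "finite G" "g \<in> G"
  shows "g \<in> monomials G 1"
proof -
  have "(\<Prod>h\<in>G. h ^ (if h = g then 1 else 0)) = (\<Prod>h\<in>G. if h = g then h else 1)"
    by (intro prod.cong) auto
  also have "\<dots> = g"
    using assms by simp
  finally show ?thesis
    unfolding monomials_def by (intro CollectI exI[of _ "\<lambda>h. if h = g then 1 else 0"]) auto
qed

lemma monomials_mono: "s \<le> t \<Longrightarrow> monomials G s \<subseteq> monomials G t"
  unfolding monomials_def using order_trans by blast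

lemma monomials_split:
  assumes "m \<in> monomials G s" "p > 0"
  shows "\<exists>u\<in>monomials G (s div p). \<exists>v\<in>monomials G (p - 1). m = u ^ p * v"
proof -
  obtain \<alpha> where \<alpha>: "m = (\<Prod>g\<in>G. g ^ \<alpha> g)" "\<forall>g\<in>G. \<alpha> g \<le> s"
    using assms by (auto simp: monomials_def)
  have "m = (\<Prod>g\<in>G. (g ^ (\<alpha> g div p)) ^ p * g ^ (\<alpha> g mod p))"
    unfolding \<alpha>(1) by (intro prod.cong) (auto simp flip: power_mult power_add)
  also have "\<dots> = (\<Prod>g\<in>G. g ^ (\<alpha> g div p)) ^ p * (\<Prod>g\<in>G. g ^ (\<alpha> g mod p))"
    by (simp add: prod.distrib prod_power_distrib)
  moreover have "(\<Prod>g\<in>G. g ^ (\<alpha> g div p)) \<in> monomials G (s div p)"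
    unfolding monomials_def using \<alpha>(2) by (intro CollectI exI[of _ "\<lambda>g. \<alpha> g div p"]) (auto intro: div_le_mono)
  moreover have "\<alpha> g mod p \<le> p - 1" for g
    using mod_less_divisor[OF assms(2), of "\<alpha> g"] by linarith
  then have "(\<Prod>g\<in>G. g ^ (\<alpha> g mod p)) \<in> monomials G (p - 1)"
    unfolding monomials_def by (intro CollectI exI[of _ "\<lambda>g. \<alpha> g mod p"]) auto
  ultimately show ?thesis
    by auto
qed

definition polys :: "'a::field set \<Rightarrow> nat \<Rightarrow> 'a set" where
  "polys G s = add_span (monomials G s)"

lemma polys_0: "0 \<in> polys G s"
  unfolding polys_def by (rule add_span.zero)

lemma polys_1: "1 \<in> polys G s"
  unfolding polys_def by (intro add_span_superset one_in_monomials)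

lemma polys_add: "x \<in> polys G s \<Longrightarrow> y \<in> polys G s \<Longrightarrow> x + y \<in> polys G s"
  unfolding polys_def by (rule add_span_add)

lemma polys_sum: "(\<And>i. i \<in> I \<Longrightarrow> f i \<in> polys G s) \<Longrightarrow> sum f I \<in> polys G s"
  by (induction I rule: infinite_finite_induct) (auto intro: polys_0 polys_add)

lemma polys_mult: "x \<in> polys G s \<Longrightarrow> y \<in> polys G t \<Longrightarrow> x * y \<in> polys G (s + t)"
  unfolding polys_def by (erule add_span_mult) (auto intro: monomials_mult)

lemma polys_power: "x \<in> polys G s \<Longrightarrow> x ^ n \<in> polys G (n * s)"
  by (induction n) (auto intro: polys_1 polys_mult)

lemma polys_mono: "s \<le> t \<Longrightarrow> polys G s \<subseteq> polys G t"
  unfolding polys_def by (intro add_span_mono monomials_mono)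

lemma generator_in_polys: "finite G \<Longrightarrow> g \<in> G \<Longrightarrow> g \<in> polys G 1"
  unfolding polys_def by (intro add_span_superset generator_in_monomials)

lemma polys_uminus:
  fixes x :: "'a::field"
  assumes "x \<in> polys G s" "CHAR('a) > 0"
  shows "- x \<in> polys G s"
proof -
  have "of_nat n * x \<in> polys G s" for n
    by (induction n) (auto simp: distrib_right intro: polys_0 polys_add assms(1))
  moreover have "of_nat (CHAR('a) - 1) * x = - x"
    using assms(2) by (simp add: of_nat_diff)
  ultimately show ?thesis
    by metis
qed

lemma finite_polys: "finite G \<Longrightarrow> CHAR('a::field) > 0 \<Longrightarrow> finite (polys (G :: 'a set) s)"
  unfolding polys_def by (intro finite_add_span finite_monomials)

text \<open>Frobenius is additive, so the p-th powers attached to the same reduced monomial v merge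
  into one. The v may be dependent over the p-th powers, so the coefficients are not unique; what
  counts is that their degree bound is divided by p.\<close>

lemma polys_frobenius_split:
  fixes G :: "'a::field set"
  assumes p: "p = CHAR('a)" "p > 0" and "finite G" "y \<in> polys G s"
  shows "\<exists>z. (\<forall>v. z v \<in> polys G (s div p)) \<and> y = (\<Sum>v\<in>monomials G (p - 1). z v ^ p * v)"
  using assms(4) unfolding polys_def[of G s]
proof induction
  case zero
  show ?case
    by (intro exI[of _ "\<lambda>_. 0"]) (use p in \<open>auto intro: polys_0 simp: power_0_left\<close>)
next
  case (step m y)
  then obtain z where z: "\<And>v. z v \<in> polys G (s div p)" "y = (\<Sum>v\<in>monomials G (p - 1). z v ^ p * v)"
    by blast
  obtain u w where uw: "u \<in> monomials G (s div p)" "w \<in> monomials G (p - 1)" "m = u ^ p * w"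
    using monomials_split[OF step.hyps(1) p(2)] by blast
  define z' where "z' = (\<lambda>v. z v + (if v = w then u else 0))"
  have "prime CHAR('a)"
    using p prime_CHAR_semidom by blast
  then have "z' v ^ p * v = (if v = w then m else 0) + z v ^ p * v" for v
    unfolding z'_def using p uw(3) by (simp add: freshmans_dream algebra_simps)
  then have "(\<Sum>v\<in>monomials G (p - 1). z' v ^ p * v) = m + y"
    using z(2) uw(2) finite_monomials[OF \<open>finite G\<close>] by (simp add: sum.distrib)
  moreover have "z' v \<in> polys G (s div p)" for v
    unfolding z'_def using z(1) add_span_superset[OF uw(1)]
    by (auto simp: polys_def intro: add_span_add)
  ultimately show ?case
    by metis
qed

text \<open>For finite \<open>G\<close> in positive characteristic, the subfield generated by
  \<open>G\<close>.\<close>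

definition fracs :: "'a::field set \<Rightarrow> 'a set" where
  "fracs G = {a / b | a b s. a \<in> polys G s \<and> b \<in> polys G s \<and> b \<noteq> 0}"

lemma fracsI: "a \<in> polys G s \<Longrightarrow> b \<in> polys G t \<Longrightarrow> b \<noteq> 0 \<Longrightarrow> a / b \<in> fracs G"
  unfolding fracs_def using polys_mono[of s "max s t" G] polys_mono[of t "max s t" G]
  by (intro CollectI exI[of _ a] exI[of _ b] exI[of _ "max s t"]) auto

lemma polys_subset_fracs: "polys G s \<subseteq> fracs G"
  using fracsI[OF _ polys_1] by fastforce

lemma is_subfield_fracs:
  fixes G :: "'a::field set"
  assumes "CHAR('a) > 0"
  shows "is_subfield (fracs G)"
proof -
  have "x - y \<in> fracs G \<and> x * y \<in> fracs G \<and> x / y \<in> fracs G"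
    if xy: "x \<in> fracs G" "y \<in> fracs G" for x y
  proof -
    obtain a b s c d t where ab: "a \<in> polys G s" "b \<in> polys G s" "b \<noteq> 0" "x = a / b"
      and cd: "c \<in> polys G t" "d \<in> polys G t" "d \<noteq> 0" "y = c / d"
      using xy unfolding fracs_def by blast
    have "x - y = (a * d + - (b * c)) / (b * d)"
      using ab cd by (simp add: field_simps)
    moreover have "a * d + - (b * c) \<in> polys G (s + t)"
      using ab cd assms by (intro polys_add polys_uminus polys_mult)
    moreover have "x * y = (a * c) / (b * d)"
      using ab cd by simp
    moreover have "x / y = (if c = 0 then 0 else (a * d) / (b * c))"
      using ab cd by simp
    moreover have zero: "0 \<in> fracs G"
      using polys_subset_fracs polys_0 by blast
    ultimately show ?thesis
      using ab cd fracsI[OF _ polys_mult[of b G s d t], of "a * d + - (b * c)" "s + t"]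
        fracsI[OF polys_mult[of a G s c t] polys_mult[of b G s d t]]
        fracsI[OF polys_mult[of a G s d t] polys_mult[of b G s c t]]
      by (cases "c = 0") auto
  qed
  then show ?thesis
    unfolding is_subfield_def using polys_subset_fracs[of G 0] polys_0[of G 0] polys_1[of G 0] by blast
qed

lemma fracs_common_denominator:
  fixes h :: "'b \<Rightarrow> 'a::field"
  assumes "finite V" "\<And>v. v \<in> V \<Longrightarrow> h v \<in> fracs G"
  shows "\<exists>D t. D \<noteq> 0 \<and> D \<in> polys G t \<and> (\<forall>v\<in>V. h v * D \<in> polys G t)"
  using assms
proof (induction V)
  case empty
  show ?case
    by (intro exI[of _ 1]) (simp add: polys_1)
next
  case (insert w V)
  then obtain D t where D: "D \<noteq> 0" "D \<in> polys G t" "\<And>v. v \<in> V \<Longrightarrow> h v * D \<in> polys G t"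
    by blast
  obtain a b s where ab: "a \<in> polys G s" "b \<in> polys G s" "b \<noteq> 0" "h w = a / b"
    using insert.prems unfolding fracs_def by blast
  have "h v * (D * b) \<in> polys G (t + s)" if "v \<in> insert w V" for v
  proof (cases "v = w")
    case True
    then have "h v * (D * b) = D * a"
      using ab by simp
    then show ?thesis
      using polys_mult[OF D(2) ab(1)] by (simp only:)
  next
    case False
    then show ?thesis
      using polys_mult[OF D(3) ab(2), of v] that by (simp add: mult.assoc)
  qed
  moreover have "D * b \<noteq> 0" "D * b \<in> polys G (t + s)"
    using D ab polys_mult by auto
  ultimately show ?case
    by blast
qed

lemma is_subfield_power_image:
  fixes F :: "'a::field set"
  assumes F: "is_subfield F" and q: "q = CHAR('a) ^ k" "CHAR('a) > 0"
  shows "is_subfield ((\<lambda>x. x ^ q) ` F)"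
proof -
  have pr: "prime CHAR('a)"
    using q prime_CHAR_semidom by blast
  have q0: "q > 0"
    using q by simp
  have diff: "(x - y) ^ q = x ^ q - y ^ q" for x y :: 'a
    using freshmans_dream'[OF pr q(1), of "x - y" y] by simp
  have "x ^ q - y ^ q \<in> (\<lambda>x. x ^ q) ` F \<and> x ^ q * y ^ q \<in> (\<lambda>x. x ^ q) ` F \<and>
      x ^ q / y ^ q \<in> (\<lambda>x. x ^ q) ` F"
    if "x \<in> F" "y \<in> F" for x y
    using that is_subfieldD(3-5)[OF F] by (auto simp flip: diff power_mult_distrib power_divide)
  moreover have "0 \<in> (\<lambda>x. x ^ q) ` F" "1 \<in> (\<lambda>x. x ^ q) ` F"
    using is_subfieldD(1,2)[OF F] q0 by (auto simp: image_iff intro: bexI[of _ 0] bexI[of _ 1])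
  ultimately show ?thesis
    unfolding is_subfield_def by auto
qed

lemma power_CHAR_inj:
  fixes x y :: "'a::field"
  assumes "q = CHAR('a) ^ k" "CHAR('a) > 0" "x ^ q = y ^ q"
  shows "x = y"
proof -
  have "prime CHAR('a)"
    using assms prime_CHAR_semidom by blast
  then have "(x - y) ^ q + y ^ q = x ^ q"
    using freshmans_dream'[OF _ assms(1), of "x - y" y] by simp
  then show ?thesis
    using assms by simp
qed

text \<open>
  With $R_s$ the polynomials of degree at most $s$ in each generator, $W = D^{-2} R_s$ for a common
  denominator $D$ of the values of a $p$-th root of a retraction of the field onto its $p$-th
  powers: root extraction divides degrees by $p$, which compensates for the factor $\rho^r$.
\<close>

lemma finite_root_closed_set:
  fixes G :: "'a::field set"
  assumes p: "p = CHAR('a)" "p > 0" and G: "finite G"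
  shows "\<exists>W. finite W \<and> G \<subseteq> W \<and>
    (\<forall>y\<in>W. \<forall>\<rho>\<in>G. \<forall>r<p. \<forall>\<mu>\<in>fracs G. \<mu> ^ p = y * \<rho> ^ r \<longrightarrow> \<mu> \<in> W)"
proof -
  have pr: "prime CHAR('a)"
    using p prime_CHAR_semidom by blast
  then have p2: "p \<ge> 2"
    using p prime_ge_2_nat by blast
  \<comment> \<open>The retraction is taken onto the p-th powers, so that its values have the form
    \<open>h v ^ p\<close> and a root can be extracted after applying it.\<close>
  define F where "F = (\<lambda>x. x ^ p) ` fracs G"
  define V where "V = monomials G (p - 1)"
  have V: "finite V"
    unfolding V_def by (rule finite_monomials[OF G])
  have F: "is_subfield F"
    unfolding F_def 
    using is_subfield_power_image[of "fracs G" p 1] is_subfield_fracs[of G] p by simp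
  obtain \<kappa> where \<kappa>: "\<And>v. \<kappa> v \<in> F"
    "\<And>x. (\<forall>v\<in>V. x v \<in> F) \<Longrightarrow> (\<Sum>v\<in>V. x v * v) \<in> F \<Longrightarrow> (\<Sum>v\<in>V. x v * v) = (\<Sum>v\<in>V. x v * \<kappa> v)"
    using subfield_retraction[OF F V, of "\<lambda>v. v"] by blast
  have "\<exists>h. h \<in> fracs G \<and> \<kappa> v = h ^ p" for v
    using \<kappa>(1)[of v] by (auto simp: F_def)
  then obtain h where h: "\<And>v. h v \<in> fracs G" "\<And>v. \<kappa> v = h v ^ p"
    by metis
  obtain D t where D: "D \<noteq> 0" "D \<in> polys G t" "\<And>v. v \<in> V \<Longrightarrow> h v * D \<in> polys G t"
    using fracs_common_denominator[OF V, of h G] h(1) by blast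
  \<comment> \<open>Chosen so that s div 2 + (1 + t) + t = s: root extraction at least halves s, the
    factors \<rho>^r and D^(p-2) add at most 1 + t after division by p, and multiplication by
    \<open>h v * D\<close> adds t.\<close>
  define s where "s = 2 + 4 * t"
  define W where "W = (\<lambda>z. z / D ^ 2) ` polys G s"
  have "finite W"
    unfolding W_def using finite_polys[OF G] p by blast
  moreover have "G \<subseteq> W"
  proof
    fix g assume "g \<in> G"
    then have "g * D ^ 2 \<in> polys G (1 + 2 * t)"
      by (intro polys_mult polys_power generator_in_polys G D)
    then have "g * D ^ 2 \<in> polys G s"
      using polys_mono[of "1 + 2 * t" s G] by (auto simp: s_def)
    then show "g \<in> W"
      unfolding W_def using D(1) by (intro image_eqI[of _ _ "g * D ^ 2"]) auto
  qed
  moreover have "\<mu> \<in> W" if y: "y \<in> W" and \<rho>: "\<rho> \<in> G" and r: "r < p" and \<mu>: "\<mu> \<in> fracs G" "\<mu> ^ p = y * \<rho> ^ r"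
    for y \<rho> \<mu> r
  proof -
    obtain z where z: "z \<in> polys G s" "y = z / D ^ 2"
      using y by (auto simp: W_def)
    \<comment> \<open>A single factor D before taking the p-th power is enough: as p \<ge> 2, D^p
      cancels the denominator D^2 of y.\<close>
    have "D ^ p = D ^ 2 * D ^ (p - 2)"
      using p2 by (metis le_add_diff_inverse power_add)
    then have eq: "(\<mu> * D) ^ p = z * \<rho> ^ r * D ^ (p - 2)"
      using D(1) by (simp add: power_mult_distrib \<mu>(2) z(2) power2_eq_square)
    have "z * \<rho> ^ r * D ^ (p - 2) \<in> polys G (s + r * 1 + (p - 2) * t)"
      by (intro polys_mult polys_power z D generator_in_polys G \<rho>)
    then obtain c where c: "\<And>v. c v \<in> polys G ((s + r * 1 + (p - 2) * t) div p)"
      "(\<mu> * D) ^ p = (\<Sum>v\<in>V. c v ^ p * v)"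
      using polys_frobenius_split[OF p G] unfolding eq V_def by blast
    have cF: "c v \<in> fracs G" for v
      using c(1) polys_subset_fracs by blast
    have DF: "D \<in> fracs G"
      using D(2) polys_subset_fracs by blast
    have "\<mu> * D \<in> fracs G"
      using is_subfieldD(4)[OF is_subfield_fracs] p \<mu>(1) DF by metis
    then have "(\<Sum>v\<in>V. c v ^ p * v) \<in> F"
      unfolding c(2)[symmetric] F_def by blast
    \<comment> \<open>The sum lies in F, so every v may be replaced by \<kappa> v, which makes the
      right-hand side a p-th power.\<close>
    then have "(\<mu> * D) ^ p = (\<Sum>v\<in>V. c v ^ p * \<kappa> v)"
      unfolding c(2) using cF by (intro \<kappa>(2)) (auto simp: F_def)
    also have "\<dots> = (\<Sum>v\<in>V. c v * h v) ^ p"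
      by (simp add: freshmans_dream_sum[OF pr p(1)] h(2) power_mult_distrib)
    finally have "\<mu> * D = (\<Sum>v\<in>V. c v * h v)"
      using power_CHAR_inj[of p 1] p by auto
    then have "\<mu> * D ^ 2 = (\<Sum>v\<in>V. c v * (h v * D))"
      by (simp add: power2_eq_square sum_distrib_right algebra_simps)
        (simp flip: mult.assoc add: sum_distrib_right sum_distrib_left)
    also have "\<dots> \<in> polys G ((s + r * 1 + (p - 2) * t) div p + t)"
      using c(1) D(3) by (intro polys_sum polys_mult)
    also have "\<dots> \<subseteq> polys G s"
    proof (rule polys_mono)
      have "s + r * 1 + (p - 2) * t \<le> s + p * (1 + t)"
        using r by (auto intro!: add_mono simp: algebra_simps)
      then have "(s + r * 1 + (p - 2) * t) div p \<le> (s + p * (1 + t)) div p"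
        by (rule div_le_mono)
      also have "\<dots> = s div p + (1 + t)"
        by (subst div_mult_self2) (use p(2) in auto)
      also have "s div p \<le> s div 2"
        using p2 by (intro div_le_mono2) auto
      finally show "(s + r * 1 + (p - 2) * t) div p + t \<le> s"
        by (simp add: s_def)
    qed
    finally show ?thesis
      unfolding W_def using D(1) by (intro image_eqI[of _ _ "\<mu> * D ^ 2"]) auto
  qed
  ultimately show ?thesis
    by (intro exI[of _ W] conjI ballI allI impI) assumption+
qed

subsection \<open>Frobenius orbits\<close>

lemma homogeneous_system_solvable:
  fixes x :: "'t \<Rightarrow> 'i \<Rightarrow> 'a::field"
  assumes "finite D" "finite T" "card D < card T"
  shows "\<exists>c. (\<exists>t\<in>T. c t \<noteq> 0) \<and> (\<forall>i\<in>D. (\<Sum>t\<in>T. c t * x t i) = 0)"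
  using assms
proof (induction D arbitrary: T x)
  case empty
  then obtain t where "t \<in> T"
    by fastforce
  then show ?case
    by (intro exI[of _ "\<lambda>_. 1"]) auto
next
  case (insert a D)
  show ?case
  proof (cases "\<exists>t\<in>T. x t a \<noteq> 0")
    case False
    have "\<exists>c. (\<exists>t\<in>T. c t \<noteq> 0) \<and> (\<forall>i\<in>D. (\<Sum>t\<in>T. c t * x t i) = 0)"
      using insert by (intro insert.IH) auto
    then show ?thesis
      using False by auto
  next
    case True
    then obtain t0 where t0: "t0 \<in> T" "x t0 a \<noteq> 0"
      by blast
    let ?T = "T - {t0}"
    have "card D < card ?T"
      using insert.hyps insert.prems t0(1) by simp
    then have "\<exists>c. (\<exists>t\<in>?T. c t \<noteq> 0) \<and>
        (\<forall>i\<in>D. (\<Sum>t\<in>?T. c t * (x t i - x t a / x t0 a * x t0 i)) = 0)"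
      using insert.prems by (intro insert.IH) auto
    then obtain c where c: "\<exists>t\<in>?T. c t \<noteq> 0"
      "\<And>i. i \<in> D \<Longrightarrow> (\<Sum>t\<in>?T. c t * (x t i - x t a / x t0 a * x t0 i)) = 0"
      by blast
    define d where "d = - (\<Sum>t\<in>?T. c t * (x t a / x t0 a))"
    define c' where "c' = c(t0 := d)"
    have split: "(\<Sum>t\<in>T. c' t * x t i) = d * x t0 i + (\<Sum>t\<in>?T. c t * x t i)" for i
    proof -
      have "(\<Sum>t\<in>?T. c' t * x t i) = (\<Sum>t\<in>?T. c t * x t i)"
        by (intro sum.cong) (auto simp: c'_def)
      then show ?thesis
        using t0(1) insert.prems(1) by (simp add: sum.remove c'_def)
    qed
    have "(\<Sum>t\<in>T. c' t * x t i) = 0" if "i \<in> insert a D" for i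
    proof (cases "i = a")
      case True
      then show ?thesis
        using t0(2) by (simp add: split d_def sum_distrib_right)
    next
      case False
      then have "(\<Sum>t\<in>?T. c t * x t i) = (\<Sum>t\<in>?T. c t * (x t a / x t0 a)) * x t0 i"
        using c(2)[of i] that by (simp add: algebra_simps sum_subtractf sum_distrib_left)
      then show ?thesis
        by (simp add: split d_def)
    qed
    moreover have "\<exists>t\<in>T. c' t \<noteq> 0"
      using c(1) by (auto simp: c'_def)
    ultimately show ?thesis
      by blast
  qed
qed

text \<open>More vectors than coordinates give some relation; the point is a nonzero coefficient at
  the first vector. \<open>shift\<close> removes leading zeros one at a time, dividing by the v i
  and taking q-th roots, and the closing induction raises a relation to the q-th power to pass from
  j to j + 1.\<close>

lemma frobenius_orbit_relation:
  fixes x :: "nat \<Rightarrow> 'i \<Rightarrow> 'a::alg_closed_field"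
  assumes q: "q = CHAR('a) ^ l" "CHAR('a) > 0"
    and rec: "\<And>k i. i \<in> D \<Longrightarrow> x (Suc k) i = v i * x k i ^ q" and v: "\<And>i. i \<in> D \<Longrightarrow> v i \<noteq> 0"
    and "finite D"
  shows "\<exists>c N. c 0 \<noteq> 0 \<and> (\<forall>i\<in>D. (\<Sum>t\<le>N. c t * x (t + j) i) = 0)"
proof -
  have pr: "prime CHAR('a)"
    using q prime_CHAR_semidom by blast
  have q0: "q > 0"
    using q by simp
  have shift: "\<exists>c N. c 0 \<noteq> 0 \<and> (\<forall>i\<in>D. (\<Sum>t\<le>N. c t * x t i) = 0)"
    if "c a \<noteq> 0" "a \<le> N" "\<And>t. t < a \<Longrightarrow> c t = 0" "\<forall>i\<in>D. (\<Sum>t\<le>N. c t * x t i) = 0"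
    for c :: "nat \<Rightarrow> 'a" and a N
    using that
  proof (induction a arbitrary: c N)
    case 0
    then show ?case
      by blast
  next
    case (Suc a)
    obtain M where M: "N = Suc M"
      using Suc.prems(2) by (cases N) auto
    obtain \<mu> where \<mu>: "\<And>t. \<mu> t ^ q = c (Suc t)"
      using choice[of "\<lambda>t y. y ^ q = c (Suc t)"] nth_root_exists[OF q0] by blast
    have "(\<Sum>t\<le>M. \<mu> t * x t i) = 0" if "i \<in> D" for i
    proof -
      have "0 = (\<Sum>t\<le>M. c (Suc t) * x (Suc t) i)"
        using Suc.prems(3)[of 0] Suc.prems(4) that unfolding M sum.atMost_Suc_shift by simp
      also have "\<dots> = v i * (\<Sum>t\<le>M. \<mu> t * x t i) ^ q"
        by (simp add: freshmans_dream_sum'[OF pr q(1)] sum_distrib_left rec[OF that] power_mult_distrib \<mu>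
            mult.left_commute)
      finally show ?thesis
        using v[OF that] by simp
    qed
    moreover have "\<mu> t = 0" if "t < a" for t
      using \<mu>[of t] Suc.prems(3)[of "Suc t"] that q0 by simp
    moreover have "\<mu> a \<noteq> 0"
      using \<mu>[of a] Suc.prems(1) q0 by (metis power_0_left less_irrefl)
    ultimately show ?case
      using Suc.IH[of \<mu> M] Suc.prems(2) M by auto
  qed
  have "\<exists>c N. c 0 \<noteq> 0 \<and> (\<forall>i\<in>D. (\<Sum>t\<le>N. c t * x t i) = 0)"
  proof -
    obtain c where c: "\<exists>t\<in>{..card D}. c t \<noteq> 0" "\<forall>i\<in>D. (\<Sum>t\<le>card D. c t * x t i) = 0"
      using homogeneous_system_solvable[OF \<open>finite D\<close>, of "{..card D}" x] by auto
    define a where "a = (LEAST t. c t \<noteq> 0)"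
    obtain t where "t \<le> card D" "c t \<noteq> 0"
      using c(1) by auto
    then have "c a \<noteq> 0" "a \<le> card D" "\<And>t. t < a \<Longrightarrow> c t = 0"
      unfolding a_def using LeastI[of "\<lambda>t. c t \<noteq> 0" t] Least_le[of "\<lambda>t. c t \<noteq> 0" t]
      by (auto dest: not_less_Least)
    then show ?thesis
      using shift c(2) by blast
  qed
  then show ?thesis
  proof (induction j)
    case (Suc j)
    then obtain c N where c: "c 0 \<noteq> 0" "\<And>i. i \<in> D \<Longrightarrow> (\<Sum>t\<le>N. c t * x (t + j) i) = 0"
      by blast
    have "(\<Sum>t\<le>N. c t ^ q * x (t + Suc j) i) = 0" if "i \<in> D" for i
    proof -
      have "(\<Sum>t\<le>N. c t ^ q * x (t + Suc j) i) = v i * (\<Sum>t\<le>N. c t * x (t + j) i) ^ q"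
        by (simp add: freshmans_dream_sum'[OF pr q(1)] sum_distrib_left rec[OF that] power_mult_distrib
            mult.left_commute)
      then show ?thesis
        using c(2)[OF that] q0 by simp
    qed
    then show ?case
      using c(1) by (intro exI[of _ "\<lambda>t. c t ^ q"] exI[of _ N]) auto
  qed auto
qed

text \<open>
  By Frobenius, a linear relation among the vectors $x_k$ can be shifted forwards, and backwards
  because coefficients have $q$-th roots. Hence each $x_j$ is a combination of later vectors.
\<close>

lemma frobenius_orbit_tail:
  fixes x :: "nat \<Rightarrow> 'i \<Rightarrow> 'a::alg_closed_field"
  assumes q: "q = CHAR('a) ^ l" "CHAR('a) > 0"
    and rec: "\<And>k i. i \<in> D \<Longrightarrow> x (Suc k) i = v i * x k i ^ q" and v: "\<And>i. i \<in> D \<Longrightarrow> v i \<noteq> 0"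
    and "finite D" and tail: "\<And>k. k \<ge> j \<Longrightarrow> (\<Sum>i\<in>D. u i * x k i) = 0"
  shows "(\<Sum>i\<in>D. u i * x k i) = 0"
proof -
  have "\<forall>k\<ge>j - m. (\<Sum>i\<in>D. u i * x k i) = 0" for m
  proof (induction m)
    case (Suc m)
    define j' where "j' = j - Suc m"
    obtain c N where c: "c 0 \<noteq> 0" "\<And>i. i \<in> D \<Longrightarrow> (\<Sum>t\<le>N. c t * x (t + j') i) = 0"
      using frobenius_orbit_relation[where x = x and v = v and j = j', OF q rec v \<open>finite D\<close>] by blast
    have "(\<Sum>t\<le>N. c t * (\<Sum>i\<in>D. u i * x (t + j') i)) = (\<Sum>i\<in>D. u i * (\<Sum>t\<le>N. c t * x (t + j') i))"
      unfolding sum_distrib_left by (subst sum.swap) (simp add: mult.left_commute)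
    also have "\<dots> = 0"
      using c(2) by simp
    finally have "(\<Sum>t\<le>N. c t * (\<Sum>i\<in>D. u i * x (t + j') i)) = 0" .
    moreover have "(\<Sum>i\<in>D. u i * x (t + j') i) = 0" if "t > 0" for t
      using Suc.IH that by (simp add: j'_def)
    then have "(\<Sum>t\<le>N. c t * (\<Sum>i\<in>D. u i * x (t + j') i)) = c 0 * (\<Sum>i\<in>D. u i * x j' i)"
      by (subst sum.mono_neutral_right[of _ "{0}"]) auto
    ultimately have "(\<Sum>i\<in>D. u i * x j' i) = 0"
      using c(1) by simp
    moreover have "k = j' \<or> k \<ge> j - m" if "k \<ge> j'" for k
      using that by (auto simp: j'_def)
    ultimately show ?case
      using Suc.IH unfolding j'_def by metis
  qed (use tail in simp)
  from this[of j] show ?thesis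
    by simp
qed

definition zeros :: "('i \<Rightarrow> 'a::field) \<Rightarrow> 'i set \<Rightarrow> 'i set \<Rightarrow> ('i \<Rightarrow> 'i \<Rightarrow> 'a) \<Rightarrow> int set" where
  "zeros \<beta> I J l = {n. \<forall>j\<in>J. \<beta> j powi n = (\<Sum>i\<in>I. l j i * \<beta> i powi n)}"

text \<open>By \<open>repunit_Suc\<close>, the vectors with entries \<beta>_i^(b * repunit q k)
  satisfy x_(k+1) = \<beta>^b x_k^q coordinatewise and so form a Frobenius orbit. The constant
  factor \<beta>_i^n goes into the coefficients.\<close>

lemma tail_closed_exponential_sum:
  fixes \<beta> :: "'i \<Rightarrow> 'a::alg_closed_field"
  assumes "CHAR('a) = p" "p > 0" "finite D" and \<beta>: "\<And>i. i \<in> D \<Longrightarrow> \<beta> i \<noteq> 0"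
  shows "tail_closed (int p ^ l) {n. (\<Sum>i\<in>D. u i * \<beta> i powi n) = 0}"
  unfolding tail_closed_def
proof (intro allI impI)
  fix n b j k
  assume tail: "\<forall>k\<ge>j. n + b * repunit (int p ^ l) k \<in> {n. (\<Sum>i\<in>D. u i * \<beta> i powi n) = 0}"
  define x where "x = (\<lambda>k i. \<beta> i powi (b * repunit (int p ^ l) k))"
  have split: "(\<Sum>i\<in>D. u i * \<beta> i powi (n + b * repunit (int p ^ l) k)) = (\<Sum>i\<in>D. (u i * \<beta> i powi n) * x k i)" for k
    unfolding x_def using \<beta> by (intro sum.cong) (auto simp: power_int_add)
  have "(\<Sum>i\<in>D. (u i * \<beta> i powi n) * x k i) = 0"
  proof (rule frobenius_orbit_tail[where q = "p ^ l" and l = l and v = "\<lambda>i. \<beta> i powi b"])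
    show "x (Suc k) i = \<beta> i powi b * x k i ^ p ^ l" if "i \<in> D" for k i
      using \<beta>[OF that] unfolding x_def
      by (simp add: repunit_Suc distrib_left power_int_add power_int_power' mult_ac)
    show "(\<Sum>i\<in>D. u i * \<beta> i powi n * x k i) = 0" if "k \<ge> j" for k
      using tail that unfolding split[symmetric] by blast
  qed (use assms in auto)
  then show "n + b * repunit (int p ^ l) k \<in> {n. (\<Sum>i\<in>D. u i * \<beta> i powi n) = 0}"
    unfolding split[symmetric] by simp
qed

lemma tail_closed_zeros:
  fixes \<beta> :: "'i \<Rightarrow> 'a::alg_closed_field"
  assumes "CHAR('a) = p" "p > 0" "finite I" "I \<inter> J = {}" "\<And>i. i \<in> I \<union> J \<Longrightarrow> \<beta> i \<noteq> 0"
  shows "tail_closed (int p ^ e) (zeros \<beta> I J l)"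
proof -
  \<comment> \<open>Each equation becomes an exponential sum with coefficient -1 at j, which is
    possible because j lies outside I.\<close>
  define H where "H = (\<lambda>j. {n. (\<Sum>i\<in>insert j I. ((l j)(j := - 1)) i * \<beta> i powi n) = 0})"
  have H: "tail_closed (int p ^ e) (H j)" if "j \<in> J" for j
    unfolding H_def using assms that by (intro tail_closed_exponential_sum) auto
  have "H j = {n. \<beta> j powi n = (\<Sum>i\<in>I. l j i * \<beta> i powi n)}" if "j \<in> J" for j
  proof -
    have "j \<notin> I"
      using that assms(4) by blast
    moreover have "(\<Sum>i\<in>I. ((l j)(j := - 1)) i * \<beta> i powi n) = (\<Sum>i\<in>I. l j i * \<beta> i powi n)" for n
      using \<open>j \<notin> I\<close> by (intro sum.cong) auto
    ultimately show ?thesis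
      unfolding H_def using assms(3) by (auto simp: algebra_simps)
  qed
  then have "zeros \<beta> I J l = (\<Inter>j\<in>J. H j)"
    unfolding zeros_def by auto
  moreover have "tail_closed (int p ^ e) (\<Inter>j\<in>J. H j)"
    unfolding tail_closed_def
  proof (intro allI impI INT_I)
    fix n b k0 k j
    assume "\<forall>k\<ge>k0. n + b * repunit (int p ^ e) k \<in> (\<Inter>j\<in>J. H j)" and j: "j \<in> J"
    then have "\<forall>k\<ge>k0. n + b * repunit (int p ^ e) k \<in> H j"
      by blast
    then show "n + b * repunit (int p ^ e) k \<in> H j"
      using H[OF j] unfolding tail_closed_def by blast
  qed
  ultimately show ?thesis
    by simp
qed

subsection \<open>Zero sets of exponential systems\<close>

lemma zeros_cong:
  assumes "\<And>j i. j \<in> J \<Longrightarrow> i \<in> I \<Longrightarrow> l j i = l' j i"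
  shows "zeros \<beta> I J l = zeros \<beta> I J l'"
  using assms unfolding zeros_def by simp

lemma zeros_iff_normalized:
  fixes \<beta> :: "'i \<Rightarrow> 'a::field"
  assumes "\<And>j. j \<in> J \<Longrightarrow> \<beta> j \<noteq> 0"
  shows "n \<in> zeros \<beta> I J l \<longleftrightarrow> (\<forall>j\<in>J. (\<Sum>i\<in>I. l j i * (\<beta> i / \<beta> j) powi n) = 1)"
proof -
  have "(\<Sum>i\<in>I. l j i * (\<beta> i / \<beta> j) powi n) = (\<Sum>i\<in>I. l j i * \<beta> i powi n) / \<beta> j powi n" for j
    by (simp add: sum_divide_distrib power_int_divide_distrib)
  then show ?thesis
    using assms unfolding zeros_def by (auto simp: field_simps)
qed

text \<open>After division by \<beta>_b^n, equation b says that an F-combination of the l b i equals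
  1, an element of F. So it survives replacing l b i by \<kappa> i. The difference is a relation
  whose coefficients do not depend on n and which is nontrivial at a, since l b a is outside F.
  Solving it for \<beta>_a^n and substituting moves a to J.\<close>

lemma zeros_drop:
  fixes \<beta> :: "'i \<Rightarrow> 'a::field"
  assumes I: "finite I" and IJ: "I \<inter> J = {}" and \<beta>: "\<And>i. i \<in> I \<union> J \<Longrightarrow> \<beta> i \<noteq> 0"
    and F: "is_subfield F"
    and ratio: "\<And>i j. i \<in> I \<Longrightarrow> j \<in> J \<Longrightarrow> l j i \<noteq> 0 \<Longrightarrow> \<beta> i / \<beta> j \<in> F"
    and ia: "a \<in> I" "b \<in> J" "l b a \<notin> F"
  shows "\<exists>l'. zeros \<beta> I J l = zeros \<beta> (I - {a}) (insert a J) l'"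
proof -
  \<comment> \<open>Only the quotients at nonzero coefficients are known to lie in F, hence the
    restriction to the support.\<close>
  define E where "E = {i \<in> I. l b i \<noteq> 0}"
  have E: "finite E" "E \<subseteq> I"
    using I by (auto simp: E_def)
  obtain \<kappa> where \<kappa>: "\<And>i. \<kappa> i \<in> F" "\<And>x. (\<forall>i\<in>E. x i \<in> F) \<Longrightarrow> (\<Sum>i\<in>E. x i * l b i) \<in> F \<Longrightarrow>
      (\<Sum>i\<in>E. x i * l b i) = (\<Sum>i\<in>E. x i * \<kappa> i)"
    using subfield_retraction[OF F E(1), of "l b"] by blast
  define u where "u = (\<lambda>i. if i \<in> E then l b i - \<kappa> i else 0)"
  have aE: "a \<in> E"
    using ia is_subfieldD(1)[OF F] by (auto simp: E_def)
  have ua: "u a \<noteq> 0"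
    using aE ia(3) \<kappa>(1)[of a] by (auto simp: u_def)
  define m where "m = (\<lambda>i. - u i / u a)"
  have relation: "\<beta> a powi n = (\<Sum>i\<in>I - {a}. m i * \<beta> i powi n)" if n: "n \<in> zeros \<beta> I J l" for n
  proof -
    define x where "x = (\<lambda>i. (\<beta> i / \<beta> b) powi n)"
    have "(\<Sum>i\<in>I. l b i * x i) = 1"
      using n ia(2) zeros_iff_normalized[of J \<beta> n I l] \<beta> by (simp add: x_def)
    also have "(\<Sum>i\<in>I. l b i * x i) = (\<Sum>i\<in>E. x i * l b i)"
      using I by (intro sum.mono_neutral_cong_right) (auto simp: E_def mult.commute)
    finally have one: "(\<Sum>i\<in>E. x i * l b i) = 1" .
    have "x i \<in> F" if "i \<in> E" for i
      using ratio[of i b] that ia(2) by (auto simp: E_def x_def intro: is_subfield_powi[OF F])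
    then have "(\<Sum>i\<in>E. x i * l b i) = (\<Sum>i\<in>E. x i * \<kappa> i)"
      using one is_subfieldD(2)[OF F] by (intro \<kappa>(2)) auto
    then have "(\<Sum>i\<in>E. u i * x i) = 0"
      by (simp add: u_def algebra_simps sum_subtractf)
    then have "(\<Sum>i\<in>E. u i * \<beta> i powi n) / \<beta> b powi n = 0"
      by (simp add: x_def power_int_divide_distrib sum_divide_distrib)
    then have "(\<Sum>i\<in>E. u i * \<beta> i powi n) = 0"
      using \<beta>[of b] ia(2) by simp
    moreover have "(\<Sum>i\<in>I. u i * \<beta> i powi n) = (\<Sum>i\<in>E. u i * \<beta> i powi n)"
      using I E(2) by (intro sum.mono_neutral_right) (auto simp: u_def)
    ultimately have "u a * \<beta> a powi n + (\<Sum>i\<in>I - {a}. u i * \<beta> i powi n) = 0"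
      using I ia(1) by (simp add: sum.remove[of I a])
    then have "u a * \<beta> a powi n = - (\<Sum>i\<in>I - {a}. u i * \<beta> i powi n)"
      by (simp add: eq_neg_iff_add_eq_0)
    then have "\<beta> a powi n = - (\<Sum>i\<in>I - {a}. u i * \<beta> i powi n) / u a"
      using ua by (simp add: field_simps)
    then show ?thesis
      by (simp add: m_def sum_divide_distrib sum_negf)
  qed
  define l' where "l' = (\<lambda>j i. if j = a then m i else l j i + l j a * m i)"
  have substitute: "(\<Sum>i\<in>I. l j i * \<beta> i powi n) = (\<Sum>i\<in>I - {a}. (l j i + l j a * m i) * \<beta> i powi n)"
    if "\<beta> a powi n = (\<Sum>i\<in>I - {a}. m i * \<beta> i powi n)" for j n
  proof -
    have "(\<Sum>i\<in>I. l j i * \<beta> i powi n) = l j a * (\<Sum>i\<in>I - {a}. m i * \<beta> i powi n) + (\<Sum>i\<in>I - {a}. l j i * \<beta> i powi n)"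
      using I ia(1) that by (simp add: sum.remove[of I a])
    then show ?thesis
      by (simp add: algebra_simps sum.distrib sum_distrib_left)
  qed
  have "a \<notin> J"
    using ia(1) IJ by blast
  then have l': "l' a = m" "\<And>j. j \<in> J \<Longrightarrow> l' j = (\<lambda>i. l j i + l j a * m i)"
    by (auto simp: l'_def)
  have "n \<in> zeros \<beta> I J l \<longleftrightarrow> n \<in> zeros \<beta> (I - {a}) (insert a J) l'" for n
    using relation[of n] substitute[of n] unfolding zeros_def by (auto simp: l')
  then show ?thesis
    by blast
qed

text \<open>When p is the characteristic, p-th roots are unique, so the choice is
  immaterial.\<close>

definition child :: "nat \<Rightarrow> ('i \<Rightarrow> 'a::field) \<Rightarrow> ('i \<Rightarrow> 'i \<Rightarrow> 'a) \<Rightarrow> nat \<Rightarrow> 'i \<Rightarrow> 'i \<Rightarrow> 'a" where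
  "child p \<beta> l r j i = (SOME y. y ^ p = l j i * (\<beta> i / \<beta> j) ^ r)"

lemma child_power:
  fixes \<beta> :: "'i \<Rightarrow> 'a::alg_closed_field"
  assumes "p > 0"
  shows "child p \<beta> l r j i ^ p = l j i * (\<beta> i / \<beta> j) ^ r"
  unfolding child_def by (rule someI_ex) (rule nth_root_exists[OF assms])

lemma zeros_child:
  fixes \<beta> :: "'i \<Rightarrow> 'a::alg_closed_field"
  assumes p: "CHAR('a) = p" "p > 0" and \<beta>: "\<And>i. i \<in> I \<union> J \<Longrightarrow> \<beta> i \<noteq> 0"
  shows "int r + int p * n \<in> zeros \<beta> I J l \<longleftrightarrow> n \<in> zeros \<beta> I J (child p \<beta> l r)"
proof -
  have pr: "prime CHAR('a)"
    using p prime_CHAR_semidom by blast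
  have "(\<Sum>i\<in>I. l j i * (\<beta> i / \<beta> j) powi (int r + int p * n)) =
      (\<Sum>i\<in>I. child p \<beta> l r j i * (\<beta> i / \<beta> j) powi n) ^ p" if "j \<in> J" for j
    unfolding freshmans_dream_sum[OF pr p(1)[symmetric]]
  proof (rule sum.cong)
    fix i assume "i \<in> I"
    then have "\<beta> i / \<beta> j \<noteq> 0"
      using \<beta> that by simp
    then show "l j i * (\<beta> i / \<beta> j) powi (int r + int p * n) = (child p \<beta> l r j i * (\<beta> i / \<beta> j) powi n) ^ p"
      by (simp add: power_mult_distrib child_power[OF p(2)] power_int_add power_int_power' mult_ac
          del: divide_eq_0_iff)
  qed simp
  moreover have "x ^ p = 1 \<longleftrightarrow> x = 1" for x :: 'a
    using power_CHAR_inj[of p 1 x 1] p by auto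
  ultimately show ?thesis
    using \<beta> by (simp add: zeros_iff_normalized)
qed

lemma zeros_eq_UN_child:
  fixes \<beta> :: "'i \<Rightarrow> 'a::alg_closed_field"
  assumes p: "CHAR('a) = p" "p > 0" and \<beta>: "\<And>i. i \<in> I \<union> J \<Longrightarrow> \<beta> i \<noteq> 0"
  shows "zeros \<beta> I J l = (\<Union>r<p. (\<lambda>n. int r + int p * n) ` zeros \<beta> I J (child p \<beta> l r))"
proof (intro equalityI subsetI)
  fix n assume n: "n \<in> zeros \<beta> I J l"
  define r where "r = nat (n mod int p)"
  have r: "int r + int p * (n div int p) = n" "r < p"
    using p(2) by (simp_all add: r_def nat_less_iff)
  then have "n div int p \<in> zeros \<beta> I J (child p \<beta> l r)"
    using n zeros_child[OF p, of I J \<beta> r "n div int p" l] \<beta> by auto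
  then show "n \<in> (\<Union>r<p. (\<lambda>n. int r + int p * n) ` zeros \<beta> I J (child p \<beta> l r))"
    using r by force
qed (use zeros_child[OF p, of I J \<beta>] \<beta> in auto)

lemma subfield_power_bezout:
  assumes F: "is_subfield F" and "x ^ m \<in> F" "x ^ n \<in> F" "coprime m n" "x \<noteq> 0"
  shows "x \<in> F"
proof -
  obtain u v where uv: "u * int m + v * int n = 1"
    using bezout_int[of "int m" "int n"] assms(4) by (auto simp: coprime_iff_gcd_eq_1)
  have "x powi (u * int m + v * int n) = (x ^ m) powi u * (x ^ n) powi v"
    using \<open>x \<noteq> 0\<close> by (simp add: power_int_add power_int_power mult.commute)
  also have "\<dots> \<in> F"
    by (intro is_subfieldD(4)[OF F] is_subfield_powi[OF F] assms)
  finally show ?thesis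
    by (simp add: uv)
qed

text \<open>Composing steps collects the exceptional parts met on the way into one set with
  parameter s. The repetition Z a = Z b gives a cycle with multiplier p^(b-a); the way from 0 to a
  only contributes an affine image and a set with parameter s, so the parameter rises just
  once.\<close>

lemma p_nested_int_path:
  assumes p: "p \<ge> 2"
    and step: "\<And>k :: nat. \<exists>E. p_nested_int p s E \<and>
      (Z k = E \<or> (\<exists>w. Z k = E \<union> (\<lambda>x. w + int p * x) ` Z (Suc k)))"
    and cycle: "a < b" "Z a = Z b" and closed: "\<And>l k. tail_closed (int p ^ l) (Z k)"
  shows "p_nested_int p (Suc s) (Z 0)"
proof -
  have path: "p_nested_int p s (Z k) \<or>
      (\<exists>E w. p_nested_int p s E \<and> Z k = E \<union> (\<lambda>x. w + int p ^ j * x) ` Z (k + j))" for j k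
  proof (induction j)
    case 0
    have "Z k = {} \<union> (\<lambda>x. 0 + int p ^ 0 * x) ` Z (k + 0)"
      by simp
    then show ?case
      using p_nested_int_empty by blast
  next
    case (Suc j)
    show ?case
    proof (cases "p_nested_int p s (Z k)")
      case False
      then obtain E w where E: "p_nested_int p s E" "Z k = E \<union> (\<lambda>x. w + int p ^ j * x) ` Z (k + j)"
        using Suc.IH by blast
      obtain E' where E': "p_nested_int p s E'"
        "Z (k + j) = E' \<or> (\<exists>w'. Z (k + j) = E' \<union> (\<lambda>x. w' + int p * x) ` Z (Suc (k + j)))"
        using step by blast
      let ?E = "E \<union> (\<lambda>x. w + int p ^ j * x) ` E'"
      have N: "p_nested_int p s ?E"
        by (intro p_nested_int_Un p_nested_int_affine E(1) E'(1))
      from E'(2) show ?thesis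
      proof
        assume "Z (k + j) = E'"
        then have "Z k = ?E"
          using E(2) by metis
        then show ?thesis
          using N by metis
      next
        assume "\<exists>w'. Z (k + j) = E' \<union> (\<lambda>x. w' + int p * x) ` Z (Suc (k + j))"
        then obtain w' where w': "Z (k + j) = E' \<union> (\<lambda>x. w' + int p * x) ` Z (Suc (k + j))"
          by blast
        have "Z k = ?E \<union> (\<lambda>x. (w + int p ^ j * w') + int p ^ Suc j * x) ` Z (Suc (k + j))"
          unfolding E(2) w' image_Un image_image Un_assoc by (simp add: algebra_simps)
        then show ?thesis
          using N by (metis add_Suc_right)
      qed
    qed simp
  qed
  have "p_nested_int p (Suc s) (Z a)"
  proof (cases "p_nested_int p s (Z a)")
    case True
    then show ?thesis
      by (rule p_nested_int_mono) simp
  next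
    case False
    then obtain E w where E: "p_nested_int p s E" "Z a = E \<union> (\<lambda>x. w + int p ^ (b - a) * x) ` Z (a + (b - a))"
      using path by blast
    moreover have "a + (b - a) = b"
      using cycle(1) by simp
    ultimately have "Z a = E \<union> (\<lambda>x. w + int p ^ (b - a) * x) ` Z a"
      using cycle(2) by metis
    moreover have "b - a \<ge> 1"
      using cycle(1) by simp
    ultimately show ?thesis
      using p_nested_int_cycle[OF p _ _ E(1) closed, of "b - a" a w] by blast
  qed
  then have cycle_part: "p_nested_int p (Suc s) ((\<lambda>x. w + int p ^ a * x) ` Z a)" for w
    by (rule p_nested_int_affine)
  have mono: "p_nested_int p (Suc s) E" if "p_nested_int p s E" for E
    using that by (rule p_nested_int_mono) simp
  consider "p_nested_int p s (Z 0)"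
    | E w where "p_nested_int p s E" "Z 0 = E \<union> (\<lambda>x. w + int p ^ a * x) ` Z a"
    using path[of 0 a] by auto
  then show ?thesis
  proof cases
    case 2
    then show ?thesis
      using p_nested_int_Un[OF mono cycle_part] by metis
  qed (rule mono)
qed

text \<open>Otherwise the p^k-th roots of x, extracted successively with digit r = 0, all stay in a
  finite root-closed set. Two of them coincide, and y_a = y_b gives x^(p^b) = x^(p^a).\<close>

lemma infinite_order_not_all_powers:
  fixes x :: "'a::alg_closed_field"
  assumes p: "p = CHAR('a)" "p > 0" and "finite G" "x \<in> G" "x \<noteq> 0" and order: "\<And>n :: nat. n > 0 \<Longrightarrow> x ^ n \<noteq> 1"
  shows "\<exists>k. x \<notin> (\<lambda>y. y ^ p ^ k) ` fracs G"
proof (rule ccontr)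
  assume "\<not> ?thesis"
  then have "\<forall>k. \<exists>y. y \<in> fracs G \<and> x = y ^ p ^ k"
    by blast
  then obtain y where y: "\<And>k. y k \<in> fracs G" "\<And>k. x = y k ^ p ^ k"
    by metis
  obtain W where W: "finite W" "G \<subseteq> W"
    "\<And>z \<rho> r \<mu>. z \<in> W \<Longrightarrow> \<rho> \<in> G \<Longrightarrow> r < p \<Longrightarrow> \<mu> \<in> fracs G \<Longrightarrow> \<mu> ^ p = z * \<rho> ^ r \<Longrightarrow> \<mu> \<in> W"
    using finite_root_closed_set[OF p \<open>finite G\<close>] by metis
  have "y k \<in> W" for k
  proof (induction k)
    case 0
    then show ?case
      using y(2)[of 0] W(2) \<open>x \<in> G\<close> by auto
  next
    case (Suc k)
    have "(y (Suc k) ^ p) ^ p ^ k = y k ^ p ^ k"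
      using y(2)[of k] y(2)[of "Suc k"] by (simp flip: power_mult)
    then have "y (Suc k) ^ p = y k"
      using power_CHAR_inj[of "p ^ k" k] p by blast
    then show ?case
      using W(3)[OF Suc.IH \<open>x \<in> G\<close> p(2) y(1)[of "Suc k"]] by simp
  qed
  then have "\<not> inj y"
    using W(1) by (metis finite_imageD finite_subset image_subsetI infinite_UNIV_nat)
  then obtain a b where ab: "a < b" "y a = y b"
    unfolding inj_def by (metis linorder_neqE_nat)
  have "x ^ p ^ b = (y a ^ p ^ a) ^ p ^ b"
    using y(2)[of a] by simp
  also have "\<dots> = (y b ^ p ^ b) ^ p ^ a"
    by (simp add: ab(2) mult.commute flip: power_mult)
  also have "\<dots> = x ^ p ^ a"
    using y(2)[of b] by simp
  finally have "x ^ p ^ b = x ^ p ^ a" .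
  moreover have "p \<ge> 2"
    using p prime_CHAR_semidom prime_ge_2_nat by blast
  then have less: "p ^ a < p ^ b"
    using ab(1) by simp
  then have "x ^ p ^ b = x ^ p ^ a * x ^ (p ^ b - p ^ a)"
    by (simp flip: power_add)
  ultimately show False
    using order[of "p ^ b - p ^ a"] less \<open>x \<noteq> 0\<close> by simp
qed

theorem p_nested_int_zeros:
  fixes \<beta> :: "'i \<Rightarrow> 'a::alg_closed_field"
  assumes p: "CHAR('a) = p" "p > 0"
    and "finite I" "finite J" "J \<noteq> {}" "I \<inter> J = {}" "\<And>i. i \<in> I \<union> J \<Longrightarrow> \<beta> i \<noteq> 0"
    and "\<And>i j n. i \<in> I \<union> J \<Longrightarrow> j \<in> I \<union> J \<Longrightarrow> i \<noteq> j \<Longrightarrow> n > 0 \<Longrightarrow> (\<beta> i / \<beta> j) ^ n \<noteq> 1"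
  shows "p_nested_int p (card I) (zeros \<beta> I J l)"
  using assms(3-8)
proof (induction "card I" arbitrary: I J l rule: less_induct)
  case less
  note I = less.prems(1) and J = less.prems(2) and IJ = less.prems(4)
    and \<beta> = less.prems(5) and order = less.prems(6)
  have pr: "prime p"
    using p prime_CHAR_semidom by blast
  then have p2: "p \<ge> 2"
    by (rule prime_ge_2_nat)
  \<comment> \<open>Root extraction preserves this support, so the subfield chosen for l below
    serves all its descendants.\<close>
  define edges where "edges = {(j, i). j \<in> J \<and> i \<in> I \<and> l j i \<noteq> 0}"
  show ?case
  proof (cases "edges = {}")
    case True
    \<comment> \<open>Every right-hand side is 0 here. This includes the case of empty I, where the
      induction ends.\<close>
    obtain j where j: "j \<in> J"
      using less.prems(3) by blast
    have "n \<notin> zeros \<beta> I J l" for n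
    proof
      assume "n \<in> zeros \<beta> I J l"
      then have "\<beta> j powi n = (\<Sum>i\<in>I. l j i * \<beta> i powi n)"
        using j by (simp add: zeros_def)
      also have "\<dots> = 0"
        using True j by (intro sum.neutral) (auto simp: edges_def)
      finally show False
        using \<beta>[of j] j by simp
    qed
    then have "zeros \<beta> I J l = {}"
      by blast
    then show ?thesis
      by simp
  next
    case False
    define s where "s = card I - 1"
    have s: "card I = Suc s"
    proof -
      have "I \<noteq> {}"
        using False by (auto simp: edges_def)
      then show ?thesis
        using I card_gt_0_iff[of I] by (simp add: s_def)
    qed
    have ratio_nz: "\<beta> i / \<beta> j \<noteq> 0" if "i \<in> I" "j \<in> J" for i j
      using \<beta> that by simp
    define G where "G = (\<lambda>(j, i). l j i) ` (J \<times> I) \<union> (\<lambda>(j, i). \<beta> i / \<beta> j) ` (J \<times> I)"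
    have G: "finite G" "\<And>j i. j \<in> J \<Longrightarrow> i \<in> I \<Longrightarrow> l j i \<in> G" "\<And>j i. j \<in> J \<Longrightarrow> i \<in> I \<Longrightarrow> \<beta> i / \<beta> j \<in> G"
      using I J by (auto simp: G_def)
    define powers where "powers = (\<lambda>k. (\<lambda>y. y ^ p ^ k) ` fracs G)"
    have powers: "is_subfield (powers k)" for k
      unfolding powers_def using is_subfield_power_image[OF is_subfield_fracs] p by blast
    have powers_0: "powers 0 = fracs G"
      by (simp add: powers_def)
    have powers_Suc: "powers (Suc k) = (\<lambda>y. y ^ p) ` powers k" for k
      unfolding powers_def image_image by (simp flip: power_mult add: mult.commute)
    have powers_subset: "powers k \<subseteq> fracs G" for k
      unfolding powers_def using is_subfieldD(7)[OF is_subfield_fracs] p by blast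
    have G_powers: "G \<subseteq> powers 0"
      using polys_subset_fracs generator_in_polys[OF G(1)] unfolding powers_0 by blast
    define bad where "bad = (\<lambda>k. \<exists>(j, i)\<in>edges. \<beta> i / \<beta> j \<notin> powers k)"
    have "\<exists>k. bad k"
    proof -
      obtain j i where ji: "j \<in> J" "i \<in> I" "l j i \<noteq> 0"
        using False by (auto simp: edges_def)
      then have "i \<noteq> j"
        using IJ by blast
      then have "\<exists>k. \<beta> i / \<beta> j \<notin> powers k"
        unfolding powers_def using order[of i j] ratio_nz G ji
        by (intro infinite_order_not_all_powers) (use p in auto)
      then show ?thesis
        using ji by (auto simp: bad_def edges_def)
    qed
    \<comment> \<open>The last level before the first failure: F will contain all relevant
      quotients, while the p-th powers of F miss some \<beta> a / \<beta> b.\<close>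
    define k where "k = (LEAST k. bad k) - 1"
    have "bad (LEAST k. bad k)"
      using \<open>\<exists>k. bad k\<close> by (auto intro: LeastI)
    moreover have "\<not> bad 0"
      using G(3) G_powers by (auto simp: bad_def edges_def)
    ultimately have "(LEAST k. bad k) = Suc k"
      unfolding k_def by (metis Suc_pred gr0I diff_Suc_1 diff_Suc_eq_diff_pred)
    then have "bad (Suc k)" "\<not> bad k"
      using \<open>bad (LEAST k. bad k)\<close> not_less_Least[of k bad] by auto
    define F where "F = powers k"
    have F: "is_subfield F"
      unfolding F_def by (rule powers)
    have F_ratio: "\<beta> i / \<beta> j \<in> F" if "i \<in> I" "j \<in> J" "l j i \<noteq> 0" for i j
      using \<open>\<not> bad k\<close> that by (auto simp: bad_def edges_def F_def)
    obtain a b where ab: "b \<in> J" "a \<in> I" "l b a \<noteq> 0" "\<beta> a / \<beta> b \<notin> (\<lambda>y. y ^ p) ` F"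
      using \<open>bad (Suc k)\<close> by (auto simp: bad_def edges_def F_def powers_Suc)
    \<comment> \<open>The nonzero pattern is that of l, so the quotients required by
      \<open>zeros_drop\<close> lie in F.\<close>
    have drop: "p_nested_int p s (zeros \<beta> I J m)"
      if m: "\<And>j i. j \<in> J \<Longrightarrow> i \<in> I \<Longrightarrow> m j i \<noteq> 0 \<longleftrightarrow> l j i \<noteq> 0"
        and out: "j \<in> J" "i \<in> I" "m j i \<notin> F" for m j i
    proof -
      have "\<exists>m'. zeros \<beta> I J m = zeros \<beta> (I - {i}) (insert i J) m'"
        by (rule zeros_drop[where F = F and b = j]) (use I IJ \<beta> F m F_ratio out in auto)
      then obtain m' where "zeros \<beta> I J m = zeros \<beta> (I - {i}) (insert i J) m'"
        by blast
      moreover have "I - {i} \<union> insert i J = I \<union> J"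
        using out by blast
      then have "p_nested_int p (card (I - {i})) (zeros \<beta> (I - {i}) (insert i J) m')"
        using I J IJ out \<beta> order s by (intro less.hyps) auto
      moreover have "card (I - {i}) = s"
        using I out s by simp
      ultimately show ?thesis
        by simp
    qed
    obtain W where W: "finite W" "G \<subseteq> W"
      "\<And>z \<rho> r \<mu>. z \<in> W \<Longrightarrow> \<rho> \<in> G \<Longrightarrow> r < p \<Longrightarrow> \<mu> \<in> fracs G \<Longrightarrow> \<mu> ^ p = z * \<rho> ^ r \<Longrightarrow> \<mu> \<in> W"
      using finite_root_closed_set[OF p(1)[symmetric] p(2) G(1)] by metis
    \<comment> \<open>Invariant along the path of digits. It is preserved because W is closed under
      root extraction inside the field, and since W is finite, only finitely many systems occur on J
      \<times> I.\<close>
    define state where "state = (\<lambda>m. \<forall>j\<in>J. \<forall>i\<in>I. m j i \<in> F \<and> m j i \<in> W \<and> (m j i \<noteq> 0 \<longleftrightarrow> l j i \<noteq> 0))"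
    define good where "good = (\<lambda>m r. \<forall>j\<in>J. \<forall>i\<in>I. child p \<beta> m r j i \<in> F)"
    have child_nz: "child p \<beta> m r j i \<noteq> 0 \<longleftrightarrow> m j i \<noteq> 0" if "j \<in> J" "i \<in> I" for m r j i
    proof -
      have "child p \<beta> m r j i ^ p \<noteq> 0 \<longleftrightarrow> m j i \<noteq> 0"
        unfolding child_power[OF p(2)] using ratio_nz[OF that(2,1)] by simp
      then show ?thesis
        using p(2) by simp
    qed
    have state_child: "state (child p \<beta> m r)" if "state m" "good m r" "r < p" for m r
      unfolding state_def
    proof (intro ballI conjI)
      fix j i assume ji: "j \<in> J" "i \<in> I"
      show cF: "child p \<beta> m r j i \<in> F"
        using that(2) ji by (simp add: good_def)
      show "child p \<beta> m r j i \<in> W"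
      proof (rule W(3))
        show "m j i \<in> W"
          using that(1) ji by (simp add: state_def)
        show "child p \<beta> m r j i \<in> fracs G"
          using cF powers_subset F_def by blast
      qed (rule G(3) ji that(3) child_power[OF p(2)])+
      show "child p \<beta> m r j i \<noteq> 0 \<longleftrightarrow> l j i \<noteq> 0"
        using that(1) ji child_nz by (simp add: state_def)
    qed
    \<comment> \<open>Two good digits would put m b a * \<rho>^r and m b a * \<rho>^r' among the
      p-th powers of F, hence also \<rho>^d with 0 < d < p. As \<rho>^p is one as well, Bezout would
      make \<rho> itself a p-th power in F.\<close>
    have good_unique: "r = r'" if m: "state m" and r: "good m r" "r < p" "good m r'" "r' < p" for m r r'
    proof (rule ccontr)
      let ?\<rho> = "\<beta> a / \<beta> b" and ?F = "(\<lambda>y. y ^ p) ` F"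
      assume "r \<noteq> r'"
      have FF: "is_subfield ?F"
        using powers[of "Suc k"] by (simp add: powers_Suc F_def)
      have *: "m b a * ?\<rho> ^ t \<in> ?F" if "good m t" for t
        using child_power[OF p(2), of \<beta> m t b a] that ab(1,2) unfolding good_def by (metis image_eqI)
      have nz: "?\<rho> \<noteq> 0" "m b a \<noteq> 0"
        using ratio_nz ab(1-3) m by (auto simp: state_def)
      have "?\<rho> ^ (t' - t) \<in> ?F" if "good m t" "good m t'" "t < t'" for t t'
      proof -
        have "(m b a * ?\<rho> ^ t') / (m b a * ?\<rho> ^ t) = ?\<rho> ^ (t' - t)"
          using nz that(3) by (simp add: power_diff)
        then show ?thesis
          using is_subfieldD(5)[OF FF * *] that by metis
      qed
      moreover define d where "d = max r r' - min r r'"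
      ultimately have "?\<rho> ^ d \<in> ?F"
        using r \<open>r \<noteq> r'\<close> by (auto simp: max_def min_def)
      moreover have "0 < d" "d < p"
        using r \<open>r \<noteq> r'\<close> by (auto simp: d_def)
      then have "coprime p d"
        using pr by (intro prime_imp_coprime) (auto dest: dvd_imp_le)
      moreover have "?\<rho> ^ p \<in> ?F"
        using F_ratio ab by blast
      ultimately have "?\<rho> \<in> ?F"
        using subfield_power_bezout[OF FF] nz(1) by blast
      then show False
        using ab(4) by blast
    qed
    have closed: "tail_closed (int p ^ e) (zeros \<beta> I J m)" for e m
      using tail_closed_zeros[OF p I IJ] \<beta> by blast
    \<comment> \<open>Without a good digit, \<open>m\<close> is a dummy value that keeps the path
      total; \<open>step\<close> then holds through its first alternative.\<close>
    define succ where "succ = (\<lambda>m. if \<exists>r<p. good m r then child p \<beta> m (SOME r. r < p \<and> good m r) else m)"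
    have step: "\<exists>E. p_nested_int p s E \<and> (zeros \<beta> I J m = E \<or>
        (\<exists>w. zeros \<beta> I J m = E \<union> (\<lambda>x. w + int p * x) ` zeros \<beta> I J (succ m)))"
      if m: "state m" for m
    proof -
      define B where "B = (\<lambda>r. (\<lambda>n. int r + int p * n) ` zeros \<beta> I J (child p \<beta> m r))"
      define E where "E = (\<Union>r\<in>{r. r < p \<and> \<not> good m r}. B r)"
      have split: "zeros \<beta> I J m = (\<Union>r<p. B r)"
        unfolding B_def using zeros_eq_UN_child[OF p, of I J \<beta> m] \<beta> by blast
      have "p_nested_int p s (B r)" if bad: "\<not> good m r" for r
      proof -
        obtain j i where "j \<in> J" "i \<in> I" "child p \<beta> m r j i \<notin> F"
          using bad by (auto simp: good_def)
        then show ?thesis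
          unfolding B_def using child_nz m by (intro p_nested_int_affine drop) (auto simp: state_def)
      qed
      then have E: "p_nested_int p s E"
        unfolding E_def by (intro p_nested_int_UN) auto
      show ?thesis
      proof (cases "\<exists>r<p. good m r")
        case True
        define r where "r = (SOME r. r < p \<and> good m r)"
        have r: "r < p" "good m r"
          using someI_ex[OF True[unfolded Bex_def]] by (auto simp: r_def)
        have "{..<p} = {r. r < p \<and> \<not> good m r} \<union> {r}"
          using r good_unique[OF m] by blast
        then have "zeros \<beta> I J m = E \<union> B r"
          unfolding split E_def by blast
        moreover have "succ m = child p \<beta> m r"
          using True by (simp add: succ_def r_def)
        ultimately show ?thesis
          using E unfolding B_def by metis
      next
        case False
        then have "zeros \<beta> I J m = E"
          unfolding split E_def by blast
        then show ?thesis
          using E by metis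
      qed
    qed
    have state_next: "state (succ m)" if "state m" for m
    proof (cases "\<exists>r<p. good m r")
      case True
      define r where "r = (SOME r. r < p \<and> good m r)"
      have "r < p" "good m r"
        using someI_ex[OF True[unfolded Bex_def]] by (auto simp: r_def)
      then have "state (child p \<beta> m r)"
        using state_child[OF that] by blast
      then show ?thesis
        unfolding succ_def r_def[symmetric] using True by simp
    next
      case False
      then have "succ m = m"
        unfolding succ_def by (rule if_not_P)
      then show ?thesis
        using that by simp
    qed
    show ?thesis
    proof (cases "\<forall>j\<in>J. \<forall>i\<in>I. l j i \<in> F")
      case False
      then have "p_nested_int p s (zeros \<beta> I J l)"
        using drop[of l] by blast
      then show ?thesis
        using p_nested_int_mono s by (metis le_SucI order_refl)
    next
      case True
      then have "state l"
        using G(2) W(2) by (auto simp: state_def)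
      then have state: "state ((succ ^^ t) l)" for t
        by (induction t) (auto intro: state_next)
      \<comment> \<open>Restriction to J \<times> I puts the states into a finite function space,
        and agreement there suffices by \<open>zeros_cong\<close>.\<close>
      define code where "code = (\<lambda>t. \<lambda>x\<in>J \<times> I. (succ ^^ t) l (fst x) (snd x))"
      have "code t \<in> (J \<times> I) \<rightarrow>\<^sub>E W" for t
        using state[of t] unfolding code_def restrict_PiE_iff by (auto simp: state_def)
      then have "range code \<subseteq> (J \<times> I) \<rightarrow>\<^sub>E W"
        by blast
      moreover have "finite ((J \<times> I) \<rightarrow>\<^sub>E W)"
        using I J W(1) by (intro finite_PiE) auto
      ultimately have "\<not> inj code"
        by (metis finite_imageD finite_subset infinite_UNIV_nat)
      then obtain t t' where t: "t < t'" "code t = code t'"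
        unfolding inj_def by (metis linorder_neqE_nat)
      have "zeros \<beta> I J ((succ ^^ t) l) = zeros \<beta> I J ((succ ^^ t') l)"
      proof (rule zeros_cong)
        fix j i assume "j \<in> J" "i \<in> I"
        then show "(succ ^^ t) l j i = (succ ^^ t') l j i"
          using fun_cong[OF t(2), of "(j, i)"] by (simp add: code_def)
      qed
      then have "p_nested_int p (Suc s) (zeros \<beta> I J ((succ ^^ 0) l))"
        using step[OF state] closed
        by (intro p_nested_int_path[OF p2 _ t(1), of s "\<lambda>t. zeros \<beta> I J ((succ ^^ t) l)"]) auto
      then show ?thesis
        by (simp add: s)
    qed
  qed
qed

subsection \<open>Translation to p-nested sets of natural numbers\<close>

lemma p_nested_int_exponential_sum:
  fixes D :: "'a::alg_closed_field set"
  assumes p: "CHAR('a) = p" "p > 0" and D: "finite D" "0 \<notin> D"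
    and order: "\<And>v w n. v \<in> D \<Longrightarrow> w \<in> D \<Longrightarrow> v \<noteq> w \<Longrightarrow> n > 0 \<Longrightarrow> (v / w) ^ n \<noteq> 1"
    and C: "v \<in> D" "C v \<noteq> 0"
  shows "p_nested_int p (card D - 1) {n. (\<Sum>w\<in>D. C w * w powi n) = 0}"
proof -
  \<comment> \<open>Solving for one root with nonzero coefficient gives J = {v}; this is where one
    is lost from \<open>card D\<close>.\<close>
  have "p_nested_int p (card (D - {v})) (zeros (\<lambda>w. w) (D - {v}) {v} (\<lambda>j i. - C i / C v))"
    using D C order by (intro p_nested_int_zeros[OF p]) auto
  moreover have "zeros (\<lambda>w. w) (D - {v}) {v} (\<lambda>j i. - C i / C v) = {n. (\<Sum>w\<in>D. C w * w powi n) = 0}"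
  proof -
    have "v powi n = (\<Sum>i\<in>D - {v}. - C i / C v * i powi n) \<longleftrightarrow> (\<Sum>w\<in>D. C w * w powi n) = 0" for n
    proof -
      define S where "S = (\<Sum>i\<in>D - {v}. C i * i powi n)"
      have "(\<Sum>i\<in>D - {v}. - C i / C v * i powi n) = - S / C v"
        by (simp add: S_def sum_divide_distrib sum_negf)
      moreover have "(\<Sum>w\<in>D. C w * w powi n) = C v * v powi n + S"
        using D C by (simp add: S_def sum.remove)
      moreover have "v powi n = - S / C v \<longleftrightarrow> C v * v powi n + S = 0"
      proof -
        have "C v * v powi n + S = C v * (v powi n + S / C v)"
          using C(2) by (simp add: distrib_left)
        then show ?thesis
          using C(2) by (simp add: eq_neg_iff_add_eq_0)
      qed
      ultimately show ?thesis
        by (simp only:)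
    qed
    then show ?thesis
      by (simp add: zeros_def)
  qed
  ultimately show ?thesis
    using D C by simp
qed

lemma nest_iff:
  "x \<in> nest q 0 bs n \<longleftrightarrow> (\<exists>k. x = n + (\<Sum>i<length bs. bs ! i * repunit q (k i)))"
proof (induction bs arbitrary: n)
  case (Cons b bs)
  have "x \<in> nest q 0 (b # bs) n \<longleftrightarrow>
      (\<exists>k0 k. x = n + b * repunit q k0 + (\<Sum>i<length bs. bs ! i * repunit q (k i)))"
    by (simp add: Cons.IH)
  also have "\<dots> \<longleftrightarrow> (\<exists>k. x = n + (\<Sum>i<length (b # bs). (b # bs) ! i * repunit q (k i)))"
  proof
    assume "\<exists>k0 k. x = n + b * repunit q k0 + (\<Sum>i<length bs. bs ! i * repunit q (k i))"
    then obtain k0 k where "x = n + b * repunit q k0 + (\<Sum>i<length bs. bs ! i * repunit q (k i))"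
      by blast
    then show "\<exists>k. x = n + (\<Sum>i<length (b # bs). (b # bs) ! i * repunit q (k i))"
      by (intro exI[of _ "case_nat k0 k"]) (simp add: sum.lessThan_Suc_shift del: sum.lessThan_Suc)
  next
    assume "\<exists>k. x = n + (\<Sum>i<length (b # bs). (b # bs) ! i * repunit q (k i))"
    then obtain k where "x = n + (\<Sum>i<length (b # bs). (b # bs) ! i * repunit q (k i))"
      by blast
    then show "\<exists>k0 k. x = n + b * repunit q k0 + (\<Sum>i<length bs. bs ! i * repunit q (k i))"
      by (intro exI[of _ "k 0"] exI[of _ "\<lambda>i. k (Suc i)"])
        (simp add: sum.lessThan_Suc_shift del: sum.lessThan_Suc)
  qed
  finally show ?case .
qed simp

lemma nest_filter: "nest q 0 (filter (\<lambda>b. b \<noteq> 0) bs) n = nest q 0 bs n"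
  by (induction bs arbitrary: n) auto

text \<open>A nest without positive entries is bounded above and so contains finitely many naturals.
  This separates the finite part from the elementary sets, which require some c_i > 0.\<close>

lemma nest_nonpos_le:
  assumes "q \<ge> 0" "\<forall>b\<in>set bs. b \<le> 0" "x \<in> nest q 0 bs n"
  shows "x \<le> n"
  using assms(2,3)
proof (induction bs arbitrary: n)
  case (Cons b bs)
  then obtain k where "x \<le> n + b * repunit q k"
    by auto
  moreover have "repunit q k \<ge> 0"
    using assms(1) by (simp add: repunit_def sum_nonneg)
  then have "b * repunit q k \<le> 0"
    using Cons.prems(1) by (simp add: mult_nonpos_nonneg)
  ultimately show ?case
    by linarith
qed simp

lemma elementary_nest:
  assumes p: "p \<ge> 2" and e: "e \<ge> 1" and bs: "\<forall>b\<in>set bs. b \<noteq> 0" "\<exists>b\<in>set bs. b > 0"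
  shows "elementary_p_nested p (length bs) {m. int m \<in> nest (int p ^ e) 0 bs n}"
proof -
  define r where "r = length bs"
  define q where "q = p ^ e"
  have "p ^ 1 \<le> q"
    unfolding q_def using p e by (intro power_increasing) auto
  then have q2: "q \<ge> 2"
    using p by simp
  \<comment> \<open>Inverts b_i = (q - 1) c_i and n = c_0 + ... + c_r; the list is indexed from 0,
    the c_i from 1.\<close>
  define c where "c = (\<lambda>i. rat_of_int (bs ! (i - 1)) / (of_nat q - 1))"
  define c0 where "c0 = rat_of_int n - (\<Sum>i=1..r. c i)"
  have q1: "rat_of_nat q - 1 \<noteq> 0"
    using q2 by simp
  have ci: "(of_nat q - 1) * c i = of_int (bs ! (i - 1))" for i
    using q1 by (simp add: c_def)
  have mem: "bs ! (i - 1) \<in> set bs" if "i \<in> {1..r}" for i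
    using that by (auto simp: r_def)
  have "r \<ge> 1"
    using bs(2) unfolding r_def by (cases bs) auto
  moreover have "(of_nat q - 1) * c i \<in> \<int>" for i
    unfolding ci by simp
  moreover have "(of_nat q - 1) * c0 \<in> \<int>"
    unfolding c0_def right_diff_distrib sum_distrib_left ci by (intro Ints_diff Ints_mult Ints_sum) auto
  moreover have "c0 + (\<Sum>i=1..r. c i) \<in> \<int>"
    unfolding c0_def by simp
  moreover have "c i \<noteq> 0" if "i \<in> {1..r}" for i
    using bs(1) mem[OF that] q1 by (simp add: c_def)
  moreover have "\<exists>i\<in>{1..r}. c i > 0"
  proof -
    obtain i where i: "i < r" "bs ! i > 0"
      using bs(2) by (auto simp: in_set_conv_nth r_def)
    then have "c (Suc i) > 0"
      using q2 by (simp add: c_def)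
    then show ?thesis
      using i(1) by (intro bexI[of _ "Suc i"]) auto
  qed
  moreover have "{m. int m \<in> nest (int p ^ e) 0 bs n} = S_set q c0 c r"
  proof -
    have sum_eq: "c0 + (\<Sum>i=1..r. c i * of_nat q ^ k i) =
        rat_of_int (n + (\<Sum>i<r. bs ! i * repunit (int q) (k (Suc i))))" for k
    proof -
      have term_eq: "c i * of_nat q ^ k i - c i = of_int (bs ! (i - 1) * repunit (int q) (k i))" for i
      proof -
        have geometric: "of_nat q ^ k i - 1 = (of_nat q - 1) * rat_of_int (repunit (int q) (k i))"
          using arg_cong[OF repunit_closed[of "int q" "k i"], of rat_of_int] by simp
        have "c i * of_nat q ^ k i - c i = c i * (of_nat q ^ k i - 1)"
          by (simp add: algebra_simps)
        also have "\<dots> = c i * ((of_nat q - 1) * rat_of_int (repunit (int q) (k i)))"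
          by (simp only: geometric)
        also have "\<dots> = ((of_nat q - 1) * c i) * rat_of_int (repunit (int q) (k i))"
          by simp
        finally show ?thesis
          unfolding ci by simp
      qed
      have "c0 + (\<Sum>i=1..r. c i * of_nat q ^ k i) = of_int n + (\<Sum>i=1..r. c i * of_nat q ^ k i - c i)"
        by (simp add: c0_def sum_subtractf)
      also have "\<dots> = of_int n + (\<Sum>i=1..r. rat_of_int (bs ! (i - 1) * repunit (int q) (k i)))"
        unfolding term_eq by simp
      also have "(\<Sum>i=1..r. rat_of_int (bs ! (i - 1) * repunit (int q) (k i))) =
          (\<Sum>i<r. rat_of_int (bs ! i * repunit (int q) (k (Suc i))))"
        by (rule sum.reindex_bij_witness[of _ Suc "\<lambda>i. i - 1"]) auto
      finally show ?thesis
        by simp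
    qed
    have "int m \<in> nest (int p ^ e) 0 bs n \<longleftrightarrow> m \<in> S_set q c0 c r" for m
    proof -
      have "int m \<in> nest (int p ^ e) 0 bs n \<longleftrightarrow>
          (\<exists>k. int m = n + (\<Sum>i<r. bs ! i * repunit (int q) (k i)))"
        by (simp add: nest_iff q_def r_def)
      also have "\<dots> \<longleftrightarrow> (\<exists>k. int m = n + (\<Sum>i<r. bs ! i * repunit (int q) (k (Suc i))))"
      proof
        assume "\<exists>k. int m = n + (\<Sum>i<r. bs ! i * repunit (int q) (k i))"
        then obtain k where "int m = n + (\<Sum>i<r. bs ! i * repunit (int q) (k i))"
          by blast
        then show "\<exists>k. int m = n + (\<Sum>i<r. bs ! i * repunit (int q) (k (Suc i)))"
          by (intro exI[of _ "\<lambda>i. k (i - 1)"]) simp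
      next
        assume "\<exists>k. int m = n + (\<Sum>i<r. bs ! i * repunit (int q) (k (Suc i)))"
        then obtain k where "int m = n + (\<Sum>i<r. bs ! i * repunit (int q) (k (Suc i)))"
          by blast
        then show "\<exists>k. int m = n + (\<Sum>i<r. bs ! i * repunit (int q) (k i))"
          by (intro exI[of _ "\<lambda>i. k (Suc i)"])
      qed
      also have "\<dots> \<longleftrightarrow> m \<in> S_set q c0 c r"
      proof -
        have "rat_of_nat m = of_int z \<longleftrightarrow> int m = z" for z
          by (metis of_int_eq_iff of_int_of_nat_eq)
        then show ?thesis
          unfolding S_set_def sum_eq mem_Collect_eq by (simp only:)
      qed
      finally show ?thesis .
    qed
    then show ?thesis
      by blast
  qed
  ultimately show ?thesis
    unfolding elementary_p_nested_def r_def[symmetric] using e q_def by blast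
qed

lemma p_nested_UN:
  assumes "finite A" "\<And>x. x \<in> A \<Longrightarrow> finite (f x) \<or> (\<exists>r. int r \<le> k \<and> elementary_p_nested p r (f x))"
  shows "p_nested p k (\<Union>x\<in>A. f x)"
proof -
  define A1 where "A1 = {x \<in> A. finite (f x)}"
  have "(\<Union>x\<in>A. f x) = (\<Union>x\<in>A1. f x) \<union> \<Union>(f ` (A - A1))"
    by (auto simp: A1_def)
  moreover have "finite (\<Union>x\<in>A1. f x)" "finite (f ` (A - A1))"
    using assms(1) by (auto simp: A1_def)
  moreover have "\<forall>S\<in>f ` (A - A1). \<exists>r. int r \<le> k \<and> elementary_p_nested p r S"
    using assms(2) by (auto simp: A1_def)
  ultimately show ?thesis
    unfolding p_nested_def by blast
qed

text \<open>The bound on k is asked only for r \<ge> 1, as nests without positive entries go into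
  the finite part. So k = d - 2 is admissible with s = d - 1 truncated at 0, even when k is
  negative.\<close>

lemma p_nested_of_int:
  assumes p: "p \<ge> 2" and Z: "p_nested_int p s Z" and k: "\<And>r. r \<ge> 1 \<Longrightarrow> r < s \<Longrightarrow> int r \<le> k"
  shows "p_nested p k {m. int m \<in> Z}"
proof -
  obtain e A where e: "e \<ge> 1" and A: "finite A" "\<forall>(bs, n)\<in>A. length bs < s"
    "Z = (\<Union>(bs, n)\<in>A. nest (int p ^ e) 0 bs n)"
    using Z unfolding p_nested_int_def nested_def by blast
  define f where "f = (\<lambda>(bs, n). {m. int m \<in> nest (int p ^ e) 0 bs n})"
  have "finite (f x) \<or> (\<exists>r. int r \<le> k \<and> elementary_p_nested p r (f x))" if "x \<in> A" for x
  proof -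
    obtain bs n where x: "x = (bs, n)"
      by (cases x)
    define bs' where "bs' = filter (\<lambda>b. b \<noteq> 0) bs"
    have fx: "f x = {m. int m \<in> nest (int p ^ e) 0 bs' n}"
      by (simp add: f_def x bs'_def nest_filter)
    show ?thesis
    proof (cases "\<exists>b\<in>set bs'. b > 0")
      case True
      have "elementary_p_nested p (length bs') (f x)"
        unfolding fx by (intro elementary_nest[OF p e _ True]) (auto simp: bs'_def)
      moreover have "length bs' < s"
      proof -
        have "length bs < s"
          using A(2) that x by auto
        then show ?thesis
          using length_filter_le[of "\<lambda>b. b \<noteq> 0" bs] unfolding bs'_def by linarith
      qed
      moreover have "length bs' \<ge> 1"
        using True by (cases bs') auto
      ultimately show ?thesis
        using k by blast
    next
      case False
      have "int m \<le> n" if "m \<in> f x" for m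
        using that False nest_nonpos_le[of "int p ^ e" bs' "int m" n] unfolding fx by (auto simp: not_less)
      then have "f x \<subseteq> {..nat n}"
        by fastforce
      then show ?thesis
        using finite_subset by blast
    qed
  qed
  then have "p_nested p k (\<Union>x\<in>A. f x)"
    by (rule p_nested_UN[OF A(1)])
  moreover have "(\<Union>x\<in>A. f x) = {m. int m \<in> Z}"
    unfolding A(3) f_def by auto
  ultimately show ?thesis
    by simp
qed

subsection \<open>Reduction of recurrences to exponential sums\<close>

text \<open>The action of polynomials on sequences in which the variable acts as the shift. A
  recurrence says that its characteristic polynomial annihilates the sequence.\<close>

definition shift_act :: "'a::comm_ring_1 poly \<Rightarrow> (nat \<Rightarrow> 'a) \<Rightarrow> nat \<Rightarrow> 'a" where
  "shift_act f b n = (\<Sum>i\<le>degree f. coeff f i * b (n + i))"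

lemma shift_act_bound:
  assumes "degree f \<le> N"
  shows "shift_act f b n = (\<Sum>i\<le>N. coeff f i * b (n + i))"
  unfolding shift_act_def using assms
  by (intro sum.mono_neutral_left) (auto simp: coeff_eq_0)

lemma shift_act_0 [simp]: "shift_act 0 b = (\<lambda>_. 0)"
  by (simp add: shift_act_def fun_eq_iff)

lemma shift_act_pCons: "shift_act (pCons c f) b n = c * b n + shift_act f b (Suc n)"
proof -
  have "shift_act (pCons c f) b n = (\<Sum>i\<le>Suc (degree f). coeff (pCons c f) i * b (n + i))"
    by (intro shift_act_bound) (simp add: degree_pCons_le)
  also have "\<dots> = c * b n + shift_act f b (Suc n)"
    unfolding sum.atMost_Suc_shift by (simp add: shift_act_def)
  finally show ?thesis .
qed

lemma shift_act_add: "shift_act (f + g) b n = shift_act f b n + shift_act g b n"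
proof -
  define N where "N = max (degree f) (degree g)"
  have "degree (f + g) \<le> N" "degree f \<le> N" "degree g \<le> N"
    by (auto simp: N_def degree_add_le)
  then show ?thesis
    by (simp add: shift_act_bound[of _ N] distrib_right sum.distrib)
qed

lemma shift_act_smult: "shift_act (smult c f) b n = c * shift_act f b n"
  using shift_act_bound[OF degree_smult_le[of c f]]
  by (simp add: shift_act_def sum_distrib_left mult.assoc)

lemma shift_act_mult: "shift_act (f * g) b = shift_act f (shift_act g b)"
proof (induction f)
  case (pCons c f)
  show ?case
  proof
    fix n
    have "shift_act (pCons c f * g) b n = c * shift_act g b n + shift_act (f * g) b (Suc n)"
      by (simp add: shift_act_add shift_act_smult shift_act_pCons)
    then show "shift_act (pCons c f * g) b n = shift_act (pCons c f) (shift_act g b) n"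
      by (simp add: pCons.IH shift_act_pCons)
  qed
qed (simp add: fun_eq_iff)

lemma shift_act_zero_seq: "shift_act f (\<lambda>_. 0) = (\<lambda>_. 0)"
  by (simp add: shift_act_def fun_eq_iff)

lemma shift_act_monom: "shift_act (monom c k) b n = c * b (n + k)"
proof -
  have "shift_act (monom c k) b n = (\<Sum>i\<le>k. coeff (monom c k) i * b (n + i))"
    by (intro shift_act_bound degree_monom_le)
  also have "\<dots> = (\<Sum>i\<in>{k}. coeff (monom c k) i * b (n + i))"
    by (intro sum.mono_neutral_right) auto
  finally show ?thesis
    by simp
qed

lemma shift_act_diff_const: "shift_act (monom 1 k - [:c:]) b n = b (n + k) - c * b n"
proof -
  have "monom 1 k - [:c:] = monom 1 k + [:- c:]"
    by simp
  show ?thesis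
    unfolding \<open>monom 1 k - [:c:] = _\<close> by (simp add: shift_act_add shift_act_monom shift_act_pCons)
qed

text \<open>The factors X^k - y are split off one at a time. As y - z is invertible for y in Y, the
  first-order equation g(n) = b(n + k) - z b(n) has a particular solution that is again a
  combination of the powers y^m, and the remainder h is geometric with ratio z.\<close>

lemma simple_roots_solution:
  fixes b :: "nat \<Rightarrow> 'a::field"
  assumes "finite Y" "shift_act (\<Prod>y\<in>Y. monom 1 k - [:y:]) b = (\<lambda>_. 0)"
  shows "\<exists>N c. \<forall>r. \<forall>m\<ge>N. b (r + k * m) = (\<Sum>y\<in>Y - {0}. c r y * y ^ m)"
  using assms
proof (induction Y arbitrary: b)
  case empty
  moreover have "shift_act 1 b n = b n" for n
    by (simp add: one_pCons shift_act_pCons)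
  ultimately have "b n = 0" for n
    by (metis prod.empty)
  then show ?case
    by auto
next
  case (insert z Y)
  define g where "g = shift_act (monom 1 k - [:z:]) b"
  have "shift_act (\<Prod>y\<in>Y. monom 1 k - [:y:]) g = (\<lambda>_. 0)"
    unfolding g_def shift_act_mult[symmetric] using insert by (simp add: mult.commute)
  then obtain N c where c: "\<And>r m. m \<ge> N \<Longrightarrow> g (r + k * m) = (\<Sum>y\<in>Y - {0}. c r y * y ^ m)"
    using insert.IH by blast
  have g: "g n = b (n + k) - z * b n" for n
    by (simp add: g_def shift_act_diff_const)
  define d where "d = (\<lambda>r y. c r y / (y - z))"
  define h where "h = (\<lambda>r m. b (r + k * m) - (\<Sum>y\<in>Y - {0}. d r y * y ^ m))"
  have h_Suc: "h r (Suc m) = z * h r m" if "m \<ge> N" for r m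
  proof -
    have "(\<Sum>y\<in>Y - {0}. d r y * y ^ Suc m) - z * (\<Sum>y\<in>Y - {0}. d r y * y ^ m)
        = (\<Sum>y\<in>Y - {0}. c r y * y ^ m)"
      unfolding sum_distrib_left sum_subtractf[symmetric]
    proof (rule sum.cong)
      fix y assume "y \<in> Y - {0}"
      then have "y - z \<noteq> 0"
        using insert.hyps by auto
      then have "c r y = d r y * (y - z)"
        by (simp add: d_def)
      show "d r y * y ^ Suc m - z * (d r y * y ^ m) = c r y * y ^ m"
        unfolding \<open>c r y = _\<close> by (simp add: algebra_simps)
    qed simp
    then show ?thesis
      using c[OF that, of r] g[of "r + k * m"] by (simp add: h_def algebra_simps)
  qed
  have h_pow: "h r (N + t) = z ^ t * h r N" for r t
    by (induction t) (auto simp: h_Suc)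
  \<comment> \<open>The remainder is geometric only from N on, hence the division by z ^ N. For z =
    0 it vanishes from \<open>Suc N\<close> on, which is why 0 is left out of the sum and the bound
    is raised.\<close>
  define c' where "c' = (\<lambda>r y. if y = z then h r N / z ^ N else d r y)"
  have "b (r + k * m) = (\<Sum>y\<in>insert z Y - {0}. c' r y * y ^ m)" if m: "m \<ge> Suc N" for r m
  proof -
    have "(\<Sum>y\<in>Y - {0}. c' r y * y ^ m) = (\<Sum>y\<in>Y - {0}. d r y * y ^ m)"
      using insert.hyps by (intro sum.cong) (auto simp: c'_def)
    moreover have "h r m = z ^ (m - N) * h r N"
      using h_pow[of r "m - N"] m by simp
    moreover have "z ^ m = z ^ (m - N) * z ^ N"
      using m by (simp flip: power_add)
    ultimately show ?thesis
    proof (cases "z = 0")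
      case True
      have "h r m = 0"
        using \<open>h r m = _\<close> m True by (simp add: power_0_left)
      moreover have "insert z Y - {0} = Y - {0}"
        using True by simp
      ultimately show ?thesis
        using \<open>(\<Sum>y\<in>Y - {0}. c' r y * y ^ m) = _\<close> by (simp add: h_def)
    next
      case False
      then have "insert z Y - {0} = insert z (Y - {0})"
        by blast
      moreover have "c' r z * z ^ m = h r m"
        using False \<open>h r m = _\<close> \<open>z ^ m = _\<close> by (simp add: c'_def)
      ultimately show ?thesis
        using \<open>(\<Sum>y\<in>Y - {0}. c' r y * y ^ m) = _\<close> insert.hyps by (simp add: h_def)
    qed
  qed
  then show ?case
    by blast
qed

lemma monic_power_eq:
  fixes x :: "'a::field"
  assumes "CHAR('a) = p" "p > 0"
  shows "[:- x, 1:] ^ p ^ e = monom 1 (p ^ e) - [:x ^ p ^ e:]"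
proof -
  have pr: "prime CHAR('a poly)"
    using assms prime_CHAR_semidom[where 'a = 'a] by simp
  have m: "p ^ e = CHAR('a poly) ^ e"
    using assms by simp
  have "([:- x, 1:] + [:x:]) ^ p ^ e = [:- x, 1:] ^ p ^ e + [:x:] ^ p ^ e"
    by (rule freshmans_dream'[OF pr m])
  moreover have "[:- x, 1:] + [:x:] = monom 1 1"
    by (simp add: monom_Suc)
  moreover have "[:x:] ^ n = [:x ^ n:]" for n
    by (induction n) auto
  ultimately show ?thesis
    by (simp add: monom_power)
qed

text \<open>Multiple roots do not lead to polynomial coefficients here: P = p^d \<ge> d bounds all
  multiplicities, so f divides the product of (X - x)^P = X^P - x^P over its distinct roots, and the
  x^P are again distinct. Along residue classes modulo P the roots are thus simple.\<close>

lemma recurrence_exponential_form: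
  fixes b :: "nat \<Rightarrow> 'a::alg_closed_field"
  assumes p: "CHAR('a) = p" "p > 0" and rec: "has_recurrence b d"
  shows "\<exists>P N D c. P \<ge> 1 \<and> finite D \<and> card D \<le> d \<and> 0 \<notin> D \<and>
    (\<forall>r. \<forall>m\<ge>N. b (r + P * m) = (\<Sum>v\<in>D. c r v * v ^ m))"
proof -
  obtain \<gamma> where \<gamma>: "\<And>n. b (n + d) = (\<Sum>i<d. \<gamma> i * b (n + i))"
    using rec unfolding has_recurrence_def by blast
  define f where "f = monom 1 d - (\<Sum>i<d. monom (\<gamma> i) i)"
  have coeff_sum: "coeff (\<Sum>i<d. monom (\<gamma> i) i) k = (if k < d then \<gamma> k else 0)" for k
    by (simp add: coeff_sum)
  have coeff_f: "coeff f k = (if k = d then 1 else if k < d then - \<gamma> k else 0)" for k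
    by (auto simp: f_def coeff_sum)
  have "degree f = d"
    by (rule antisym) (auto simp: coeff_f intro!: degree_le le_degree)
  then have lead: "lead_coeff f = 1"
    by (simp add: coeff_f)
  have act_f: "shift_act f b = (\<lambda>_. 0)"
  proof
    fix n
    have "shift_act f b n = (\<Sum>i<d. coeff f i * b (n + i)) + b (n + d)"
      unfolding shift_act_def \<open>degree f = d\<close> lessThan_Suc_atMost[symmetric] by (simp add: coeff_f)
    also have "(\<Sum>i<d. coeff f i * b (n + i)) = - b (n + d)"
      unfolding \<gamma> sum_negf[symmetric] by (intro sum.cong) (auto simp: coeff_f)
    finally show "shift_act f b n = 0"
      by simp
  qed
  obtain A where A: "size A = d" "f = (\<Prod>x\<in>#A. [:- x, 1:])"
    using alg_closed_imp_factorization[of f] lead \<open>degree f = d\<close> by force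
  define P where "P = p ^ d"
  have "p \<ge> 2"
    using p prime_CHAR_semidom prime_ge_2_nat by blast
  then have P: "P \<ge> d" "P \<ge> 1"
    unfolding P_def using less_exp[of d] power_mono[of 2 p d] by auto
  define Y where "Y = (\<lambda>x. x ^ P) ` set_mset A"
  have inj: "inj_on (\<lambda>x. x ^ P) (set_mset A)"
    using power_CHAR_inj[of P d] p by (auto simp: inj_on_def P_def)
  have "f dvd (\<Prod>x\<in>set_mset A. [:- x, 1:] ^ P)"
    unfolding A(2) image_prod_mset_multiplicity
  proof (intro prod_dvd_prod le_imp_power_dvd)
    fix x
    show "count A x \<le> P"
      using count_le_size[of A x] A(1) P(1) by linarith
  qed
  also have "(\<Prod>x\<in>set_mset A. [:- x, 1:] ^ P) = (\<Prod>y\<in>Y. monom 1 P - [:y:])"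
    unfolding Y_def prod.reindex[OF inj] by (simp add: monic_power_eq[OF p] P_def)
  finally obtain g where "(\<Prod>y\<in>Y. monom 1 P - [:y:]) = g * f"
    by (metis dvd_def mult.commute)
  then have "shift_act (\<Prod>y\<in>Y. monom 1 P - [:y:]) b = (\<lambda>_. 0)"
    by (simp add: shift_act_mult act_f shift_act_zero_seq)
  then obtain N c where "\<And>r m. m \<ge> N \<Longrightarrow> b (r + P * m) = (\<Sum>y\<in>Y - {0}. c r y * y ^ m)"
    using simple_roots_solution[of Y P b] by (auto simp: Y_def)
  moreover have "card (Y - {0}) \<le> d"
  proof -
    have "card (Y - {0}) \<le> card Y"
      by (intro card_mono) (auto simp: Y_def)
    also have "\<dots> \<le> card (set_mset A)"
      unfolding Y_def by (intro card_image_le) auto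
    also have "\<dots> \<le> size A"
      unfolding size_multiset_overloaded_eq using sum_mono[of "set_mset A" "\<lambda>_. 1" "count A"] by (simp add: Suc_le_eq)
    finally show ?thesis
      using A(1) by simp
  qed
  moreover have "finite (Y - {0})" "0 \<notin> Y - {0}"
    by (auto simp: Y_def)
  ultimately show ?thesis
    using P(2) by (intro exI[of _ P] exI[of _ N] exI[of _ "Y - {0}"] exI[of _ c] conjI) blast+
qed

lemma common_torsion_exponent:
  fixes T :: "'a::monoid_mult set"
  assumes "finite T"
  shows "\<exists>N>0. \<forall>x\<in>T. (\<exists>n>0. x ^ n = 1) \<longrightarrow> x ^ N = 1"
  using assms
proof (induction T)
  case (insert y T)
  then obtain N where N: "N > 0" "\<forall>x\<in>T. (\<exists>n>0. x ^ n = 1) \<longrightarrow> x ^ N = 1"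
    by blast
  obtain n where n: "n > 0" "(\<exists>n>0. y ^ n = 1) \<longrightarrow> y ^ n = 1"
    by (metis zero_less_one)
  have "\<forall>x\<in>insert y T. (\<exists>n>0. x ^ n = 1) \<longrightarrow> x ^ (N * n) = 1"
  proof (intro ballI impI)
    fix x assume x: "x \<in> insert y T" "\<exists>n>0. x ^ n = 1"
    show "x ^ (N * n) = 1"
    proof (cases "x = y")
      case True
      then have "x ^ (n * N) = 1"
        using n x(2) unfolding power_mult by auto
      then show ?thesis
        by (simp add: mult.commute)
    next
      case False
      then show ?thesis
        using N x unfolding power_mult by auto
    qed
  qed
  then show ?case
    using N(1) n(1) by (metis nat_0_less_mult_iff)
qed auto

text \<open>Raising to a power t that kills all torsion quotients merges exactly the roots whose
  quotient is a root of unity. It amounts to passing from step P to step P t, and it cannot increase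
  the number of roots.\<close>

lemma exponential_form_nondegenerate:
  fixes D :: "'a::field set"
  assumes D: "finite D" "0 \<notin> D" and "P \<ge> 1"
    and b: "\<forall>r. \<forall>m\<ge>N. b (r + P * m) = (\<Sum>v\<in>D. c r v * v ^ m)"
  shows "\<exists>M D' C. M \<ge> 1 \<and> finite D' \<and> card D' \<le> card D \<and> 0 \<notin> D' \<and>
    (\<forall>v\<in>D'. \<forall>w\<in>D'. v \<noteq> w \<longrightarrow> (\<forall>n>0. (v / w) ^ n \<noteq> 1)) \<and>
    (\<forall>r<M. \<forall>m\<ge>N. b (r + M * m) = (\<Sum>v\<in>D'. C r v * v ^ m))"
proof -
  obtain t where t: "t > 0" "\<forall>x\<in>(\<lambda>(v, w). v / w) ` (D \<times> D). (\<exists>n>0. x ^ n = 1) \<longrightarrow> x ^ t = 1"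
    using common_torsion_exponent[of "(\<lambda>(v, w). v / w) ` (D \<times> D)"] D(1) by auto
  define D' where "D' = (\<lambda>v. v ^ t) ` D"
  \<comment> \<open>Roots with the same t-th power are collected; the offset \<open>r div P\<close>
    inside the longer period is absorbed into the coefficient.\<close>
  define C where "C = (\<lambda>r w. \<Sum>v\<in>{v\<in>D. v ^ t = w}. c (r mod P) v * v ^ (r div P))"
  have "\<not> (v / w) ^ n = 1" if vw: "v \<in> D'" "w \<in> D'" "v \<noteq> w" "n > 0" for v w n
  proof
    assume 1: "(v / w) ^ n = 1"
    obtain v' w' where v': "v' \<in> D" "v = v' ^ t" "w' \<in> D" "w = w' ^ t"
      using vw by (auto simp: D'_def)
    then have "(v' / w') ^ (t * n) = 1"
      using 1 by (simp add: power_mult power_divide)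
    then have "(v' / w') ^ t = 1"
      using t v' vw(4) by (metis (mono_tags, lifting) SigmaI case_prod_conv image_eqI nat_0_less_mult_iff)
    moreover have "w' \<noteq> 0"
      using v' D(2) by auto
    ultimately show False
      using v' vw(3) by (simp add: power_divide)
  qed
  moreover have "b (r + P * t * m) = (\<Sum>w\<in>D'. C r w * w ^ m)" if m: "m \<ge> N" for r m
  proof -
    have "N \<le> t * m"
      using mult_le_mono[of 1 t N m] m t(1) by simp
    then have "N \<le> r div P + t * m"
      by simp
    have "r + P * t * m = r mod P + P * (r div P + t * m)"
      by (simp add: distrib_left mult.assoc)
    then have "b (r + P * t * m) = (\<Sum>v\<in>D. c (r mod P) v * v ^ (r div P + t * m))"
      using b[rule_format, OF \<open>N \<le> r div P + t * m\<close>] by simp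
    also have "\<dots> = (\<Sum>w\<in>D'. \<Sum>v\<in>{v\<in>D. v ^ t = w}. c (r mod P) v * v ^ (r div P + t * m))"
      unfolding D'_def by (rule sum.image_gen[OF D(1)])
    also have "\<dots> = (\<Sum>w\<in>D'. C r w * w ^ m)"
      unfolding C_def sum_distrib_right
      by (intro sum.cong refl) (auto simp: power_add power_mult)
    finally show ?thesis .
  qed
  moreover have "P * t \<ge> 1"
    using \<open>P \<ge> 1\<close> t(1) by (simp add: Suc_le_eq)
  moreover have "finite D'" "card D' \<le> card D" "0 \<notin> D'"
    using D t(1) by (auto simp: D'_def card_image_le)
  ultimately show ?thesis
    by (intro exI[of _ "P * t"] exI[of _ D'] exI[of _ C] conjI) blast+
qed

theorem theorem1p8:
  fixes a :: "nat \<Rightarrow> 'a::field" and p d :: nat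
  assumes "CHAR('a) = p" and "p > 0"
    and "recurrence_order a d"
  shows "\<exists>B As. p_nested p (int d - 2) B \<and> finite As \<and> (\<forall>A\<in>As. arith_prog A) \<and>
           finite ({n. a n = 0} - (B \<union> \<Union>As) \<union> ((B \<union> \<Union>As) - {n. a n = 0}))"
proof -
  define b where "b = (\<lambda>n. to_ac (a n))"
  have p: "CHAR('a alg_closure) = p" "p > 0"
    using assms by simp_all
  have p2: "p \<ge> 2"
    using p prime_CHAR_semidom prime_ge_2_nat by blast
  obtain \<gamma> where "\<And>n. a (n + d) = (\<Sum>i<d. \<gamma> i * a (n + i))"
    using assms(3) unfolding recurrence_order_def has_recurrence_def by blast
  then have "has_recurrence b d"
    unfolding has_recurrence_def b_def by (intro exI[of _ "\<lambda>i. to_ac (\<gamma> i)"]) (simp add: to_ac_sum)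
  from recurrence_exponential_form[OF p this]
  obtain P N D c where P: "P \<ge> 1" "finite D" "card D \<le> d" "0 \<notin> D"
    and exp_form: "\<forall>r. \<forall>m\<ge>N. b (r + P * m) = (\<Sum>v\<in>D. c r v * v ^ m)"
    by (elim exE conjE) (rule that)
  from exponential_form_nondegenerate[OF P(2,4,1) exp_form]
  obtain M D' C where M: "M \<ge> 1" and D': "finite D'" "card D' \<le> card D" "0 \<notin> D'"
    and order: "\<forall>v\<in>D'. \<forall>w\<in>D'. v \<noteq> w \<longrightarrow> (\<forall>n>0. (v / w) ^ n \<noteq> 1)"
    and b: "\<forall>r<M. \<forall>m\<ge>N. b (r + M * m) = (\<Sum>v\<in>D'. C r v * v ^ m)"
    by (elim exE conjE) (rule that)
  \<comment> \<open>Classes on which all coefficients vanish give the arithmetic progressions; on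
    the others one root can be solved for.\<close>
  define zero where "zero = {r. r < M \<and> (\<forall>v\<in>D'. C r v = 0)}"
  define Y where "Y = (\<lambda>r. {n :: int. (\<Sum>v\<in>D'. C r v * v powi n) = 0})"
  define Z where "Z = (\<Union>r\<in>{..<M} - zero. (\<lambda>m. int r + int M * m) ` Y r)"
  define B where "B = {n. int n \<in> Z}"
  define As where "As = (\<lambda>r. {r + M * j |j. True}) ` zero"
  have "p_nested_int p (d - 1) (Y r)" if "r \<in> {..<M} - zero" for r
  proof -
    have "\<exists>v\<in>D'. C r v \<noteq> 0"
      using that by (auto simp: zero_def)
    then obtain v where v: "v \<in> D'" "C r v \<noteq> 0"
      by blast
    have "p_nested_int p (card D' - 1) (Y r)"
      unfolding Y_def by (rule p_nested_int_exponential_sum[where v = v]) (use p D'(1,3) order v in auto)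
    then show ?thesis
      using D'(2) P(3) by (elim p_nested_int_mono) linarith
  qed
  then have "p_nested_int p (d - 1) Z"
    unfolding Z_def by (intro p_nested_int_UN p_nested_int_affine) auto
  then have "p_nested p (int d - 2) B"
    unfolding B_def using p2 by (intro p_nested_of_int) auto
  moreover have "finite As"
    unfolding As_def zero_def by simp
  moreover have "\<forall>A\<in>As. arith_prog A"
    unfolding As_def arith_prog_def using M by blast
  \<comment> \<open>The exponential form is available only for m \<ge> N, once the effect of a root
    0 has died out; this is why finitely many n have to be excepted.\<close>
  moreover have agree: "a n = 0 \<longleftrightarrow> n \<in> B \<union> \<Union>As" if "n \<ge> M * N" for n
  proof -
    define r m where "r = n mod M" and "m = n div M"
    have n: "n = r + M * m" and r: "r < M"
      using M by (auto simp: r_def m_def)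
    have "m \<ge> N"
      unfolding m_def using that M by (simp add: less_eq_div_iff_mult_less_eq mult.commute)
    then have a: "a n = 0 \<longleftrightarrow> (\<Sum>v\<in>D'. C r v * v ^ m) = 0"
      using b[rule_format, OF r] unfolding n b_def by (metis to_ac_eq_0_iff)
    have unique: "r' = r \<and> m' = int m" if "int n = int r' + int M * m'" "r' < M" for r' m'
    proof -
      have "int r' = int n mod int M"
        using that by simp
      then have "r' = r"
        unfolding r_def by (simp flip: of_nat_mod)
      then show ?thesis
        using that(1) M unfolding n by simp
    qed
    show ?thesis
    proof (cases "r \<in> zero")
      case True
      then have "n \<in> \<Union>As"
        unfolding As_def n by blast
      then show ?thesis
        using True a by (simp add: zero_def)
    next
      case False
      have "n \<notin> \<Union>As"
      proof
        assume "n \<in> \<Union>As"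
        then obtain r' j where "r' \<in> zero" "n = r' + M * j"
          by (auto simp: As_def)
        then have "r' = r"
          using unique[of r' "int j"] by (simp add: zero_def)
        then show False
          using False \<open>r' \<in> zero\<close> by simp
      qed
      moreover have "n \<in> B \<longleftrightarrow> int m \<in> Y r"
      proof
        assume "n \<in> B"
        then obtain r' m' where "r' < M" "m' \<in> Y r'" "int n = int r' + int M * m'"
          by (auto simp: B_def Z_def)
        then show "int m \<in> Y r"
          using unique by blast
      next
        assume "int m \<in> Y r"
        moreover have "int n = int r + int M * int m"
          using n by simp
        ultimately show "n \<in> B"
          unfolding B_def Z_def using False r by blast
      qed
      ultimately show ?thesis
        using a by (simp add: Y_def)
    qed
  qed
  have "{n. a n = 0} - (B \<union> \<Union>As) \<union> ((B \<union> \<Union>As) - {n. a n = 0}) \<subseteq> {..<M * N}"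
  proof
    fix n assume "n \<in> {n. a n = 0} - (B \<union> \<Union>As) \<union> ((B \<union> \<Union>As) - {n. a n = 0})"
    then have "\<not> (a n = 0 \<longleftrightarrow> n \<in> B \<union> \<Union>As)"
      by blast
    then show "n \<in> {..<M * N}"
      using agree[of n] by (meson lessThan_iff not_le)
  qed
  then have "finite ({n. a n = 0} - (B \<union> \<Union>As) \<union> ((B \<union> \<Union>As) - {n. a n = 0}))"
    by (rule finite_subset) simp
  ultimately show ?thesis
    by (intro exI[of _ B] exI[of _ As] conjI)
qed

end
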